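(* Let $T$ be a finite tree with at least one edge, let $v\in V(T)$, and let $d=d_T(v)$. For each integer $k\ge 0$ let $T_k$ be the tree obtained from $T$ by attaching $k$ additional pendant edges at $v$, and let $\lambda_k=\lambda_{\max}(R_{T_k})$ be the largest eigenvalue of the Ricci matrix of $T_k$. Let $Q_\infty$ and $B$ be the matrices associated with $(T,v)$ defined in the context, and let $\lambda_\infty=\lambda_{\max}(Q_\infty)$. Assume that $\lambda_\infty$ is a simple eigenvalue of $Q_\infty$. Let $r,\ell$ be corresponding right and left eigenvectors satisfying $$Q_\infty r=\lambda_\infty r,\qquad \ell^{\mathsf T}Q_\infty=\lambda_\infty\ell^{\mathsf T},\qquad \ell^{\mathsf T}r=1,$$ and define $\alpha:=\ell^{\mathsf T}Br$. Then, as $k\to\infty$, $$\lambda_k=\lambda_\infty+\frac{\alpha}{d+k}+O\!\left(\frac1{(d+k)^2}\right).$$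
   Context: For a finite tree $T=(V,E)$ with at least one edge, $d_x=d_T(x)$ denotes the degree of a vertex $x$. The Ricci matrix $R_T\in\mathbb{R}^{E\times E}$ is the symmetric matrix with entries $(R_T)_{e,e}=-\bigl(\frac1{d_x}+\frac1{d_y}\bigr)$ for $e=\{x,y\}$; $(R_T)_{e,e'}=\frac1{d_z}$ if $e\ne e'$ and $e\cap e'=\{z\}$; $(R_T)_{e,e'}=0$ if $e\cap e'=\varnothing$. $\lambda_{\max}$ denotes the largest eigenvalue of a matrix all of whose eigenvalues are real. A pendant edge attached at $v$ is an edge $\{v,u\}$ where $u$ is a new vertex of degree $1$. Branches at $v$: let $u_1,\dots,u_d$ be the neighbors of $v$ in $T$, let $e_j=\{v,u_j\}$ (the root edges), and let $C_j$ be the connected component of $T-v$ containing $u_j$. The $j$-th branch edge set is $E_j=\{e_j\}\cup E(C_j)$; thus $E(T)=E_1\sqcup\dots\sqcup E_d$. The branch matrix $A_j\in\mathbb{R}^{E_j\times E_j}$ is obtained from the block of $R_T$ indexed by $E_j$ by replacing $1/d_T(v)$ by $0$: its entry at $(e_j,e_j)$ is $-1/d_T(u_j)$, and all its other entries equal the corresponding entries of $R_T$ (with degrees taken in $T$). Matrices $Q_\infty$ and $B$: both are square real matrices indexed by $E(T)\sqcup\{y\}$, where $y$ is one extra index. - $(Q_\infty)_{e,e'}=(A_j)_{e,e'}$ if $e,e'\in E_j$ for the same $j$; $(Q_\infty)_{e_j,y}=1$ for $j=1,\dots,d$; all other entries of $Q_\infty$ are $0$ (in particular the row indexed by $y$ is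 zero). All eigenvalues of $Q_\infty$ are real. - $B_{e_j,e_j}=-1$ for all $j$; $B_{e_i,e_j}=1$ for $i\neq j$; $B_{e_j,y}=-d$ and $B_{y,e_j}=1$ for all $j$; $B_{y,y}=-(d+2)$; all other entries of $B$ are $0$. "Simple" means of algebraic multiplicity one. *)

theory Defs
  imports
    "HOL-Library.Landau_Symbols"
    "Jordan_Normal_Form.Char_Poly"
    "Jordan_Normal_Form.Spectral_Radius"
begin

text \<open>Finite simple graphs are pairs (vertex set, edge set), an edge being a two-element set.\<close>

type_synonym 'a ugraph = "'a set \<times> 'a set set"

abbreviation verts :: "'a ugraph \<Rightarrow> 'a set" where
  "verts \<equiv> fst"

abbreviation edges :: "'a ugraph \<Rightarrow> 'a set set" where
  "edges \<equiv> snd"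

definition finite_simple_graph :: "'a ugraph \<Rightarrow> bool" where
  "finite_simple_graph G \<longleftrightarrow>
     finite (verts G) \<and> (\<forall>e\<in>edges G. e \<subseteq> verts G \<and> card e = 2)"

definition adj :: "'a ugraph \<Rightarrow> ('a \<times> 'a) set" where
  "adj G = {(x, y). {x, y} \<in> edges G}"

definition vdegree :: "'a ugraph \<Rightarrow> 'a \<Rightarrow> nat" where
  "vdegree G x = card {e \<in> edges G. x \<in> e}"

definition connected_graph :: "'a ugraph \<Rightarrow> bool" where
  "connected_graph G \<longleftrightarrow>
     verts G \<noteq> {} \<and> (\<forall>x\<in>verts G. \<forall>y\<in>verts G. (x, y) \<in> (adj G)\<^sup>*)"

definition is_cycle :: "'a ugraph \<Rightarrow> 'a list \<Rightarrow> bool" where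
  "is_cycle G xs \<longleftrightarrow>
     length xs \<ge> 3 \<and> distinct xs \<and>
     (\<forall>i<length xs. {xs ! i, xs ! (Suc i mod length xs)} \<in> edges G)"

definition finite_tree :: "'a ugraph \<Rightarrow> bool" where
  "finite_tree T \<longleftrightarrow>
     finite_simple_graph T \<and> connected_graph T \<and> (\<nexists>xs. is_cycle T xs)"

text \<open>The old vertices are tagged \<open>Inl\<close>; the \<open>k\<close> new leaves are \<open>Inr 0, \<dots>, Inr (k - 1)\<close>.\<close>

definition attach_pendants :: "'a ugraph \<Rightarrow> 'a \<Rightarrow> nat \<Rightarrow> ('a + nat) ugraph" where
  "attach_pendants T v k =
     (Inl ` verts T \<union> Inr ` {..<k},
      (image Inl) ` edges T \<union> (\<lambda>i. {Inl v, Inr i}) ` {..<k})"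

text \<open>
  A square matrix indexed by a finite set \<open>I\<close> is a function of two indices, of which only the
  values on \<open>I\<close> matter. It is turned into a matrix of the library by an arbitrary enumeration of
  \<open>I\<close>; the spectrum and the characteristic polynomial do not depend on the enumeration, since
  another one conjugates the matrix by a permutation matrix.
\<close>

definition enumeration :: "'i set \<Rightarrow> 'i list" where
  "enumeration I = (SOME xs. distinct xs \<and> set xs = I)"

definition to_mat :: "'i set \<Rightarrow> ('i \<Rightarrow> 'i \<Rightarrow> real) \<Rightarrow> real mat" where
  "to_mat I M =
     mat (card I) (card I) (\<lambda>(i, j). M (enumeration I ! i) (enumeration I ! j))"

text \<open>The spectrum of a real matrix consists of its real eigenvalues.\<close>

definition lambda_max :: "'i set \<Rightarrow> ('i \<Rightarrow> 'i \<Rightarrow> real) \<Rightarrow> real" where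
  "lambda_max I M = Max (spectrum (to_mat I M))"

definition alg_multiplicity :: "'i set \<Rightarrow> ('i \<Rightarrow> 'i \<Rightarrow> real) \<Rightarrow> real \<Rightarrow> nat" where
  "alg_multiplicity I M x = Polynomial.order x (char_poly (to_mat I M))"

text \<open>
  Two distinct edges share at most one vertex, so the off-diagonal sum has at most one term.
\<close>

definition ricci :: "'a ugraph \<Rightarrow> 'a set \<Rightarrow> 'a set \<Rightarrow> real" where
  "ricci T e f =
     (if e = f then - (\<Sum>x\<in>e. 1 / real (vdegree T x))
      else (\<Sum>z\<in>e \<inter> f. 1 / real (vdegree T z)))"

definition neighbors :: "'a ugraph \<Rightarrow> 'a \<Rightarrow> 'a set" where
  "neighbors T v = {u. {v, u} \<in> edges T}"

definition delete_vertex :: "'a ugraph \<Rightarrow> 'a \<Rightarrow> 'a ugraph" where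
  "delete_vertex T v = (verts T - {v}, {e \<in> edges T. v \<notin> e})"

definition component :: "'a ugraph \<Rightarrow> 'a \<Rightarrow> 'a set" where
  "component G u = {w \<in> verts G. (u, w) \<in> (adj G)\<^sup>*}"

text \<open>Branches at \<open>v\<close> are indexed by the neighbours \<open>u\<close> of \<open>v\<close>.\<close>

definition branch_edges :: "'a ugraph \<Rightarrow> 'a \<Rightarrow> 'a \<Rightarrow> 'a set set" where
  "branch_edges T v u =
     insert {v, u} {e \<in> edges T. e \<subseteq> component (delete_vertex T v) u}"

definition branch_matrix :: "'a ugraph \<Rightarrow> 'a \<Rightarrow> 'a \<Rightarrow> 'a set \<Rightarrow> 'a set \<Rightarrow> real" where
  "branch_matrix T v u e f =
     (if e = {v, u} \<and> f = {v, u} then - 1 / real (vdegree T u) else ricci T e f)"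

text \<open>
  In the index set of the two matrices below, \<open>None\<close> is the extra index \<open>y\<close>. The branch edge
  sets are pairwise disjoint, so the sum in the definition of \<open>Q_inf\<close> has at most one nonzero
  term: it is the block diagonal sum of the branch matrices.
\<close>

definition ext_edges :: "'a ugraph \<Rightarrow> 'a set option set" where
  "ext_edges T = insert None (Some ` edges T)"

definition root_edges :: "'a ugraph \<Rightarrow> 'a \<Rightarrow> 'a set set" where
  "root_edges T v = (\<lambda>u. {v, u}) ` neighbors T v"

fun Q_inf :: "'a ugraph \<Rightarrow> 'a \<Rightarrow> 'a set option \<Rightarrow> 'a set option \<Rightarrow> real" where
  "Q_inf T v (Some e) (Some f) =
     (\<Sum>u\<in>neighbors T v.
        if e \<in> branch_edges T v u \<and> f \<in> branch_edges T v u
        then branch_matrix T v u e f else 0)"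
| "Q_inf T v (Some e) None = (if e \<in> root_edges T v then 1 else 0)"
| "Q_inf T v None j = 0"

fun B_mat :: "'a ugraph \<Rightarrow> 'a \<Rightarrow> 'a set option \<Rightarrow> 'a set option \<Rightarrow> real" where
  "B_mat T v (Some e) (Some f) =
     (if e \<in> root_edges T v \<and> f \<in> root_edges T v then (if e = f then - 1 else 1) else 0)"
| "B_mat T v (Some e) None = (if e \<in> root_edges T v then - real (vdegree T v) else 0)"
| "B_mat T v None (Some f) = (if f \<in> root_edges T v then 1 else 0)"
| "B_mat T v None None = - (real (vdegree T v) + 2)"

end

theory Submission
  imports Defs
begin

text \<open>
  Put \<open>\<epsilon> = 1 / (d + k)\<close>. Edge functions of \<open>T\<^sub>k\<close> that are constant on the \<open>k\<close> new pendant edges form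
  an invariant subspace of the Ricci matrix, on which it acts as \<open>Q\<^sub>\<infinity> + \<epsilon> B\<close>; on the complementary
  functions, supported on the pendant edges with sum \<open>0\<close>, it acts as \<open>- 1 - 2 \<epsilon>\<close>. The zero row of
  \<open>Q\<^sub>\<infinity>\<close> gives \<open>\<lambda>\<^sub>\<infinity> \<ge> 0\<close>, so for large \<open>k\<close> the largest eigenvalue is that of \<open>Q\<^sub>\<infinity> + \<epsilon> B\<close>, and the
  claim becomes first-order perturbation theory of a simple eigenvalue. Convergence to \<open>\<lambda>\<^sub>\<infinity>\<close> follows
  from continuity of the characteristic polynomial, which changes sign at a simple root; the expansion
  then follows by pairing the eigenvalue equation with the left eigenvector.
\<close>

section \<open>Matrices indexed by finite sets\<close>

lemma distinct_enumeration: "finite I \<Longrightarrow> distinct (enumeration I)"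
  and set_enumeration: "finite I \<Longrightarrow> set (enumeration I) = I"
  unfolding enumeration_def by (metis (mono_tags, lifting) finite_distinct_list someI_ex)+

lemma bij_betw_enumeration:
  assumes "finite I"
  shows "bij_betw (\<lambda>k. enumeration I ! k) {0..<card I} I"
proof (rule bij_betw_nth)
  show "{0..<card I} = {..<length (enumeration I)}"
    using distinct_card[OF distinct_enumeration[OF assms]]
    by (simp add: set_enumeration assms atLeast0LessThan)
qed (simp_all add: assms distinct_enumeration set_enumeration)

lemma enumeration_nth_exhaust:
  assumes "finite I" "i \<in> I"
  obtains k where "k < card I" "enumeration I ! k = i"
  using bij_betw_imp_surj_on[OF bij_betw_enumeration[OF assms(1)]] assms(2) that by force

text \<open>The counterpart of \<open>to_mat\<close> for vectors. Both use the same enumeration, so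
  products of matrices with vectors become sums over \<open>I\<close>.\<close>

definition to_vec :: "'i set \<Rightarrow> ('i \<Rightarrow> real) \<Rightarrow> real vec" where
  "to_vec I x = vec (card I) (\<lambda>k. x (enumeration I ! k))"

lemma to_vec_carrier [simp]: "to_vec I x \<in> carrier_vec (card I)"
  by (simp add: to_vec_def)

lemma to_mat_carrier [simp]: "to_mat I M \<in> carrier_mat (card I) (card I)"
  by (simp add: to_mat_def)

lemma to_vec_eq_iff:
  assumes "finite I"
  shows "to_vec I x = to_vec I y \<longleftrightarrow> (\<forall>i\<in>I. x i = y i)"
proof
  assume "to_vec I x = to_vec I y"
  then have "x (enumeration I ! k) = y (enumeration I ! k)" if "k < card I" for k
    using that by (metis index_vec to_vec_def)
  then show "\<forall>i\<in>I. x i = y i"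
    by (metis assms enumeration_nth_exhaust)
next
  assume "\<forall>i\<in>I. x i = y i"
  then have "x (enumeration I ! k) = y (enumeration I ! k)" if "k < card I" for k
    using that bij_betwE[OF bij_betw_enumeration[OF assms]] by simp
  then show "to_vec I x = to_vec I y"
    by (auto simp: to_vec_def)
qed

lemma to_vec_zero: "to_vec I (\<lambda>_. 0) = 0\<^sub>v (card I)"
  by (auto simp: to_vec_def)

lemma smult_to_vec: "c \<cdot>\<^sub>v to_vec I x = to_vec I (\<lambda>i. c * x i)"
  by (auto simp: to_vec_def)

lemma to_vec_exhaust:
  assumes "finite I" "w \<in> carrier_vec (card I)"
  obtains x where "w = to_vec I x"
proof
  show "w = to_vec I (\<lambda>i. w $ inv_into {0..<card I} (\<lambda>k. enumeration I ! k) i)"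
    using assms bij_betw_inv_into_left[OF bij_betw_enumeration[OF assms(1)]]
    by (auto simp: to_vec_def)
qed

lemma to_mat_exhaust:
  assumes "finite I" "A \<in> carrier_mat (card I) (card I)"
  obtains M where "A = to_mat I M"
proof
  let ?g = "inv_into {0..<card I} (\<lambda>k. enumeration I ! k)"
  show "A = to_mat I (\<lambda>i j. A $$ (?g i, ?g j))"
    using assms bij_betw_inv_into_left[OF bij_betw_enumeration[OF assms(1)]]
    by (auto simp: to_mat_def)
qed

lemma to_mat_mult_to_vec:
  assumes "finite I"
  shows "to_mat I M *\<^sub>v to_vec I x = to_vec I (\<lambda>i. \<Sum>j\<in>I. M i j * x j)"
proof -
  have "(\<Sum>k\<in>{0..<card I}. M i (enumeration I ! k) * x (enumeration I ! k)) = (\<Sum>j\<in>I. M i j * x j)" for i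
    by (rule sum.reindex_bij_betw[OF bij_betw_enumeration[OF assms]])
  then show ?thesis
    by (auto simp: to_mat_def to_vec_def scalar_prod_def)
qed

section \<open>Kernels, characteristic polynomials and spectra in coordinates\<close>

lemma det_to_mat_eq_0_iff:
  assumes "finite I"
  shows "det (to_mat I M) = 0 \<longleftrightarrow>
    (\<exists>x. (\<exists>i\<in>I. x i \<noteq> 0) \<and> (\<forall>i\<in>I. (\<Sum>j\<in>I. M i j * x j) = 0))"
proof -
  have "det (to_mat I M) = 0 \<longleftrightarrow>
      (\<exists>x. to_vec I x \<noteq> to_vec I (\<lambda>_. 0) \<and> to_mat I M *\<^sub>v to_vec I x = to_vec I (\<lambda>_. 0))"
    unfolding det_0_iff_vec_prod_zero[OF to_mat_carrier] to_vec_zero[symmetric]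
    by (metis assms to_vec_carrier to_vec_exhaust)
  also have "\<dots> \<longleftrightarrow> (\<exists>x. (\<exists>i\<in>I. x i \<noteq> 0) \<and> (\<forall>i\<in>I. (\<Sum>j\<in>I. M i j * x j) = 0))"
    unfolding to_mat_mult_to_vec[OF assms] to_vec_eq_iff[OF assms] by blast
  finally show ?thesis .
qed

text \<open>Written as a determinant of an indexed matrix, the value at \<open>c\<close> can be
  treated both by kernels and by continuity in the entries.\<close>

lemma poly_char_poly_to_mat:
  assumes "finite I"
  shows "poly (char_poly (to_mat I M)) c = det (to_mat I (\<lambda>i j. (if i = j then c else 0) - M i j))"
proof -
  have "- char_matrix (to_mat I M) c = to_mat I (\<lambda>i j. (if i = j then c else 0) - M i j)"
    \<comment> \<open>Injectivity of the enumeration is what makes diagonal positions the same as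
      equal indices.\<close>
    using bij_betw_imp_inj_on[OF bij_betw_enumeration[OF assms]]
    by (auto simp: char_matrix_def to_mat_def inj_on_def)
  then show ?thesis
    by (simp add: char_poly_matrix[OF to_mat_carrier])
qed

lemma spectrum_to_mat_iff_poly:
  "c \<in> spectrum (to_mat I M) \<longleftrightarrow> poly (char_poly (to_mat I M)) c = 0"
  by (simp add: spectrum_def eigenvalue_root_char_poly[OF to_mat_carrier])

lemma spectrum_to_mat_iff:
  assumes "finite I"
  shows "c \<in> spectrum (to_mat I M) \<longleftrightarrow>
    (\<exists>x. (\<exists>i\<in>I. x i \<noteq> 0) \<and> (\<forall>i\<in>I. (\<Sum>j\<in>I. M i j * x j) = c * x i))"
proof -
  have "(\<Sum>j\<in>I. ((if i = j then c else 0) - M i j) * x j) = c * x i - (\<Sum>j\<in>I. M i j * x j)"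
    if "i \<in> I" for x i
  proof -
    have "(\<Sum>j\<in>I. ((if i = j then c else 0) - M i j) * x j) =
        (\<Sum>j\<in>I. (if i = j then c * x j else 0) - M i j * x j)"
      by (rule sum.cong) (auto simp: algebra_simps)
    then show ?thesis
      using assms that by (simp add: sum_subtractf)
  qed
  then have "(\<forall>i\<in>I. (\<Sum>j\<in>I. ((if i = j then c else 0) - M i j) * x j) = 0) \<longleftrightarrow>
      (\<forall>i\<in>I. (\<Sum>j\<in>I. M i j * x j) = c * x i)" for x
    by (intro ball_cong) auto
  then show ?thesis
    unfolding spectrum_to_mat_iff_poly poly_char_poly_to_mat[OF assms] det_to_mat_eq_0_iff[OF assms]
    by simp
qed

lemma finite_spectrum_to_mat: "finite (spectrum (to_mat I M))"
  by (rule card_finite_spectrum(1)[OF to_mat_carrier])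

text \<open>By the Leibniz formula the determinant is a polynomial in the entries.\<close>

lemma tendsto_det_to_mat:
  assumes "\<And>i j. ((\<lambda>k. M k i j) \<longlongrightarrow> N i j) F"
  shows "((\<lambda>k. det (to_mat I (M k))) \<longlongrightarrow> det (to_mat I N)) F"
  unfolding det_def'[OF to_mat_carrier]
proof (intro tendsto_intros)
  fix p i assume "p \<in> {p. p permutes {0..<card I}}" and i: "i \<in> {0..<card I}"
  then have "p i < card I"
    by (metis atLeastLessThan_iff mem_Collect_eq permutes_in_image)
  with i show "((\<lambda>k. to_mat I (M k) $$ (i, p i)) \<longlongrightarrow> to_mat I N $$ (i, p i)) F"
    by (simp add: to_mat_def assms)
qed

section \<open>Inverses, Cramer's rule and simple eigenvalues\<close>

lemma to_mat_left_inverse: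
  assumes "finite I" "det (to_mat I M) \<noteq> 0"
  obtains N where "\<And>x i. i \<in> I \<Longrightarrow> (\<Sum>j\<in>I. N i j * (\<Sum>k\<in>I. M j k * x k)) = x i"
proof -
  obtain A where A: "A \<in> carrier_mat (card I) (card I)" "A * to_mat I M = 1\<^sub>m (card I)"
    \<comment> \<open>The value \<open>()\<close> fills the extension slot of the record for the
      matrix ring.\<close>
    using det_non_zero_imp_unit[OF to_mat_carrier assms(2), of "()"]
    by (auto simp: Units_def ring_mat_def)
  then obtain N where N: "A = to_mat I N"
    using to_mat_exhaust assms(1) by blast
  have "to_vec I (\<lambda>i. \<Sum>j\<in>I. N i j * (\<Sum>k\<in>I. M j k * x k)) = to_vec I x" for x
  proof -
    have "to_vec I (\<lambda>i. \<Sum>j\<in>I. N i j * (\<Sum>k\<in>I. M j k * x k)) = A *\<^sub>v (to_mat I M *\<^sub>v to_vec I x)"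
      by (simp add: N to_mat_mult_to_vec[OF assms(1)])
    also have "\<dots> = (A * to_mat I M) *\<^sub>v to_vec I x"
      by (rule assoc_mult_mat_vec[OF A(1) to_mat_carrier to_vec_carrier, symmetric])
    finally show ?thesis
      by (simp add: A(2))
  qed
  then have "\<forall>i\<in>I. (\<Sum>j\<in>I. N i j * (\<Sum>k\<in>I. M j k * x k)) = x i" for x
    unfolding to_vec_eq_iff[OF assms(1)] .
  then show ?thesis
    by (intro that[of N]) simp
qed

text \<open>Cramer's rule, with the scalar \<open>c\<close> pulled out of the replaced column. It is
  proved over a commutative ring because it is applied to matrices of polynomials.\<close>

lemma det_replace_col_smult:
  fixes A :: "'a :: comm_ring_1 mat"
  assumes A: "A \<in> carrier_mat n n" and x: "x \<in> carrier_vec n" and w: "w \<in> carrier_vec n"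
    and k: "k < n" and eq: "A *\<^sub>v x = c \<cdot>\<^sub>v w"
  shows "x $ k * det A = c * det (replace_col A w k)"
proof -
  let ?R = "replace_col A w k"
  have R: "?R \<in> carrier_mat n n"
    using A by (auto simp: replace_col_def)
  \<comment> \<open>To pull out \<open>c\<close>, Cramer's rule is used a second time: column
    \<open>k\<close> of \<open>?R\<close> is \<open>w\<close>, so \<open>c\<close> times the
    \<open>k\<close>-th unit vector solves the system with right-hand side \<open>c\<close> times
    \<open>w\<close>.\<close>
  have "?R *\<^sub>v (c \<cdot>\<^sub>v unit_vec n k) = c \<cdot>\<^sub>v w"
  proof (rule eq_vecI)
    fix i assume "i < dim_vec (c \<cdot>\<^sub>v w)"
    then show "(?R *\<^sub>v (c \<cdot>\<^sub>v unit_vec n k)) $ i = (c \<cdot>\<^sub>v w) $ i"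
      using A R w k by (simp add: replace_col_def)
  qed (use R w in auto)
  moreover have "replace_col ?R b k = replace_col A b k" for b
    by (rule eq_matI) (auto simp: replace_col_def)
  ultimately have "c * det ?R = det (replace_col A (c \<cdot>\<^sub>v w) k)"
    using cramer_lemma_mat[OF R, of "c \<cdot>\<^sub>v unit_vec n k" k] k by simp
  then show ?thesis
    using cramer_lemma_mat[OF A x k] eq by simp
qed

text \<open>Applying Cramer's rule to \<open>[:0, 1:] - A\<close> and one eigenvector extracts one factor
  \<open>[:- c, 1:]\<close> of the characteristic polynomial; a second eigenvector, chosen with a zero where the
  column was replaced, extracts another one.\<close>

lemma order_char_poly_ge_2:
  fixes A :: "real mat"
  assumes A: "A \<in> carrier_mat n n"
    and v: "v \<in> carrier_vec n" "A *\<^sub>v v = c \<cdot>\<^sub>v v"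
    and w: "w \<in> carrier_vec n" "A *\<^sub>v w = c \<cdot>\<^sub>v w"
    and ij: "i < n" "j < n" "v $ i \<noteq> 0" "w $ i = 0" "w $ j \<noteq> 0"
  shows "Polynomial.order c (char_poly A) \<ge> 2"
proof -
  let ?h = "\<lambda>a::real. [:a:]"
  let ?P = "char_poly_matrix A"
  let ?v = "map_vec ?h v" and ?w = "map_vec ?h w"
  let ?R = "replace_col ?P ?v i"
  have P: "?P \<in> carrier_mat n n" and R: "?R \<in> carrier_mat n n"
    using carrier_matD[OF char_poly_matrix_closed[OF A]] A by (simp_all add: replace_col_def)
  have carr: "?v \<in> carrier_vec n" "?w \<in> carrier_vec n"
    using v w by auto
  \<comment> \<open>An eigenvector of \<open>A\<close>, read as a vector of constant polynomials, is
    multiplied by the linear factor belonging to \<open>c\<close>.\<close>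
  have key: "?P *\<^sub>v map_vec ?h u = [:-c, 1:] \<cdot>\<^sub>v map_vec ?h u"
    if u: "u \<in> carrier_vec n" "A *\<^sub>v u = c \<cdot>\<^sub>v u" for u
  proof (rule eq_vecI)
    fix k assume "k < dim_vec ([:-c, 1:] \<cdot>\<^sub>v map_vec ?h u)"
    then have k: "k < n" using u by simp
    have "(\<Sum>l = 0..<n. A $$ (k, l) * u $ l) = (A *\<^sub>v u) $ k"
      using A u(1) k by (simp add: scalar_prod_def)
    also have "\<dots> = c * u $ k"
      using u k by simp
    finally have eq: "(\<Sum>l = 0..<n. A $$ (k, l) * u $ l) = c * u $ k" .
    have "(?P *\<^sub>v map_vec ?h u) $ k =
        (\<Sum>l = 0..<n. ([:0, 1:] * (if k = l then 1 else 0) + [:- A $$ (k, l):]) * [:u $ l:])"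
      using A u(1) k by (auto simp: char_poly_matrix_def scalar_prod_def intro!: sum.cong)
    also have "\<dots> = (\<Sum>l = 0..<n. (if k = l then [:0, 1:] * [:u $ l:] else 0) - [:A $$ (k, l) * u $ l:])"
      by (rule sum.cong) auto
    also have "\<dots> = [:0, 1:] * [:u $ k:] - (\<Sum>l = 0..<n. [:A $$ (k, l) * u $ l:])"
      using k by (simp add: sum_subtractf)
    also have "(\<Sum>l = 0..<n. [:A $$ (k, l) * u $ l:]) = [:c * u $ k:]"
      unfolding eq[symmetric] by (simp add: sum_to_poly)
    finally show "(?P *\<^sub>v map_vec ?h u) $ k = ([:-c, 1:] \<cdot>\<^sub>v map_vec ?h u) $ k"
      using u k by simp
  qed (use u carrier_matD[OF P] in simp_all)
  have 1: "?v $ i * det ?P = [:-c, 1:] * det ?R"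
    by (rule det_replace_col_smult[OF P carr(1) carr(1) ij(1) key[OF v]])
  have "?R *\<^sub>v ?w = ?P *\<^sub>v ?w"
    using w(1) ij carrier_matD[OF P]
    by (intro eq_vecI) (auto simp: replace_col_def scalar_prod_def intro!: sum.cong)
  then have 2: "?w $ j * det ?R = [:-c, 1:] * det (replace_col ?R ?w j)"
    using det_replace_col_smult[OF R carr(2) carr(2) ij(2)] key[OF w] by simp
  have "Polynomial.smult (v $ i * w $ j) (char_poly A) = ?w $ j * (?v $ i * det ?P)"
    using ij v w by (simp add: char_poly_def)
  also have "\<dots> = [:-c, 1:] * (?w $ j * det ?R)"
    unfolding 1 by (rule mult.left_commute)
  also have "\<dots> = [:-c, 1:] ^ 2 * det (replace_col ?R ?w j)"
    unfolding 2 power2_eq_square by (rule mult.assoc[symmetric])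
  finally have "[:-c, 1:] ^ 2 dvd Polynomial.smult (v $ i * w $ j) (char_poly A)"
    by simp
  then have "[:-c, 1:] ^ 2 dvd char_poly A"
    using ij by (subst (asm) dvd_smult_iff) auto
  moreover have "char_poly A \<noteq> 0"
    using degree_monic_char_poly[OF A] by auto
  ultimately show ?thesis
    by (simp add: order_divides)
qed

text \<open>Geometric multiplicity is at most algebraic multiplicity: an eigenvector that is not a
  multiple of \<open>r\<close> would make \<open>c\<close> a root of order at least 2.\<close>

lemma simple_eigenvectors_proportional:
  assumes I: "finite I" and simple: "alg_multiplicity I M c = 1"
    and r: "\<And>i. i \<in> I \<Longrightarrow> (\<Sum>j\<in>I. M i j * r j) = c * r i" and nz: "\<exists>i\<in>I. r i \<noteq> 0"
    and x: "\<And>i. i \<in> I \<Longrightarrow> (\<Sum>j\<in>I. M i j * x j) = c * x i"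
  shows "\<exists>t. \<forall>i\<in>I. x i = t * r i"
proof (rule ccontr)
  assume neg: "\<not> ?thesis"
  from nz obtain a where a: "a \<in> I" "r a \<noteq> 0" by blast
  \<comment> \<open>The multiple of \<open>r\<close> is chosen so that \<open>w\<close> vanishes at
    \<open>a\<close>, where \<open>r\<close> does not, as \<open>order_char_poly_ge_2\<close>
    requires.\<close>
  define w where "w = (\<lambda>i. x i - x a / r a * r i)"
  from neg obtain b where b: "b \<in> I" "w b \<noteq> 0"
    unfolding w_def by (metis eq_iff_diff_eq_0)
  obtain i j where ij: "i < card I" "enumeration I ! i = a" "j < card I" "enumeration I ! j = b"
    using enumeration_nth_exhaust[OF I] a(1) b(1) by metis
  have "(\<Sum>j\<in>I. M i j * w j) = c * w i" if "i \<in> I" for i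
  proof -
    have "(\<Sum>j\<in>I. M i j * w j) = (\<Sum>j\<in>I. M i j * x j) - x a / r a * (\<Sum>j\<in>I. M i j * r j)"
      unfolding w_def sum_distrib_left sum_subtractf[symmetric]
      by (rule sum.cong) (auto simp: algebra_simps)
    then show ?thesis
      using r[OF that] x[OF that] by (simp add: w_def algebra_simps)
  qed
  then have "to_mat I M *\<^sub>v to_vec I w = c \<cdot>\<^sub>v to_vec I w"
    by (simp add: to_mat_mult_to_vec[OF I] smult_to_vec to_vec_eq_iff[OF I])
  moreover have "to_mat I M *\<^sub>v to_vec I r = c \<cdot>\<^sub>v to_vec I r"
    using r by (simp add: to_mat_mult_to_vec[OF I] smult_to_vec to_vec_eq_iff[OF I])
  moreover have "to_vec I r $ i \<noteq> 0" "to_vec I w $ i = 0" "to_vec I w $ j \<noteq> 0"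
    using a b ij by (simp_all add: to_vec_def, simp add: w_def)
  ultimately have "Polynomial.order c (char_poly (to_mat I M)) \<ge> 2"
    using ij by (intro order_char_poly_ge_2[OF to_mat_carrier to_vec_carrier _ to_vec_carrier])
  with simple show False
    by (simp add: alg_multiplicity_def)
qed

text \<open>The transposed matrix kills the unit vector at \<open>i\<close>, so the determinant is
  zero.\<close>

lemma zero_row_imp_zero_in_spectrum:
  assumes I: "finite I" and i: "i \<in> I" and zero: "\<And>j. j \<in> I \<Longrightarrow> M i j = 0"
  shows "0 \<in> spectrum (to_mat I M)"
proof -
  \<comment> \<open>This is \<open>c\<close> times the identity minus \<open>M\<close> at
    \<open>c = 0\<close>, kept in the shape of \<open>poly_char_poly_to_mat\<close>.\<close>
  let ?N = "\<lambda>a b. (if a = b then 0 else 0) - M a b"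
  have "det (to_mat I (\<lambda>a b. ?N b a)) = 0"
    unfolding det_to_mat_eq_0_iff[OF I]
  proof (intro exI conjI ballI)
    show "\<exists>j\<in>I. (if j = i then 1 else 0 :: real) \<noteq> 0"
      using i by auto
    show "(\<Sum>j\<in>I. ?N j a * (if j = i then 1 else 0)) = 0" if "a \<in> I" for a
      using that zero by (intro sum.neutral) auto
  qed
  moreover have "to_mat I (\<lambda>a b. ?N b a) = transpose_mat (to_mat I ?N)"
    by (auto simp: to_mat_def)
  ultimately have "det (to_mat I ?N) = 0"
    using det_transpose[OF to_mat_carrier] by metis
  then show ?thesis
    by (simp add: spectrum_to_mat_iff_poly poly_char_poly_to_mat[OF I])
qed

section \<open>Perturbation of a simple largest eigenvalue\<close>

text \<open>A sign change produces a real eigenvalue near \<open>c\<close>, and compactness excludes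
  eigenvalues that stay above \<open>c\<close>. The second claim is needed because a perturbed real
  matrix could have no real eigenvalue, and then \<open>Max\<close> would carry no
  information.\<close>

lemma tendsto_lambda_max:
  fixes Q B :: "'i \<Rightarrow> 'i \<Rightarrow> real" and eps :: "nat \<Rightarrow> real"
  assumes I: "finite I" and eps: "eps \<longlonglongrightarrow> 0"
    and c: "c = lambda_max I Q" and simple: "alg_multiplicity I Q c = 1"
  shows "(\<lambda>k. lambda_max I (\<lambda>i j. Q i j + eps k * B i j)) \<longlonglongrightarrow> c"
    and "\<forall>\<^sub>F k in sequentially. spectrum (to_mat I (\<lambda>i j. Q i j + eps k * B i j)) \<noteq> {}"
proof -
  define M where "M = (\<lambda>k i j. Q i j + eps k * B i j)"
  define S where "S = (\<lambda>k. spectrum (to_mat I (M k)))"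
  define p where "p = char_poly (to_mat I Q)"
  define P where "P = (\<lambda>k. char_poly (to_mat I (M k)))"
  have S_iff: "x \<in> S k \<longleftrightarrow> poly (P k) x = 0" for x k
    by (simp add: S_def P_def spectrum_to_mat_iff_poly)
  have finS: "finite (S k)" for k
    by (simp add: S_def finite_spectrum_to_mat)
  \<comment> \<open>Polynomial and argument vary together, along a subsequence, so that limits of
    eigenvalues extracted by compactness are covered.\<close>
  have lim: "(\<lambda>k. poly (P (s k)) (y k)) \<longlonglongrightarrow> poly p x"
    if "strict_mono s" and y: "y \<longlonglongrightarrow> x" for s :: "nat \<Rightarrow> nat" and y x
    unfolding P_def p_def poly_char_poly_to_mat[OF I]
  proof (rule tendsto_det_to_mat)
    have e: "(\<lambda>k. eps (s k)) \<longlonglongrightarrow> 0"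
      using LIMSEQ_subseq_LIMSEQ[OF eps that(1)] by (simp add: o_def)
    have "(\<lambda>k. (if i = j then y k else 0) - (Q i j + eps (s k) * B i j)) \<longlonglongrightarrow>
        (if i = j then x else 0) - (Q i j + 0 * B i j)" for i j
      by (cases "i = j") (auto intro!: tendsto_eq_intros y e)
    then show "(\<lambda>k. (if i = j then y k else 0) - M (s k) i j) \<longlonglongrightarrow> (if i = j then x else 0) - Q i j" for i j
      by (simp add: M_def)
  qed
  have p0: "p \<noteq> 0"
    unfolding p_def using degree_monic_char_poly[OF to_mat_carrier[of I Q]] by auto
  obtain q where q: "p = [:- c, 1:] * q" "\<not> [:- c, 1:] dvd q"
    using order_decomp[OF p0, of c] simple by (auto simp: p_def alg_multiplicity_def)
  have qc: "poly q c \<noteq> 0"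
    using q(2) by (simp add: poly_eq_0_iff_dvd)
  have near: "\<forall>\<^sub>F k in sequentially. \<exists>x\<in>S k. \<bar>x - c\<bar> < e" if e: "e > 0" for e
  proof -
    have "\<forall>\<^sub>F x in nhds c. poly q x * poly q c > 0"
    proof (rule order_tendstoD)
      show "((\<lambda>x. poly q x * poly q c) \<longlongrightarrow> poly q c * poly q c) (nhds c)"
        by (intro tendsto_intros filterlim_ident)
      show "0 < poly q c * poly q c"
        using qc by (auto simp: zero_less_mult_iff linorder_neq_iff)
    qed
    then obtain d where d: "d > 0" "\<And>x. dist x c < d \<Longrightarrow> poly q x * poly q c > 0"
      by (auto simp: eventually_nhds_metric)
    define h where "h = min d e / 2"
    have h: "0 < h" "h < d" "h < e"
      using d e by (auto simp: h_def)
    have "poly q (c - h) * poly q c > 0" "poly q (c + h) * poly q c > 0"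
      using h by (auto intro!: d(2) simp: dist_real_def)
    then have "poly q (c - h) * poly q (c + h) > 0"
      by (metis mult_pos_pos mult_neg_neg not_less_iff_gr_or_eq zero_less_mult_iff)
    then have "0 < (h * h) * (poly q (c - h) * poly q (c + h))"
      using h by simp
    \<comment> \<open>At \<open>c - h\<close> and \<open>c + h\<close> the linear factor of
      \<open>p\<close> is \<open>- h\<close> and \<open>h\<close>, while \<open>q\<close> has the
      same sign at both points.\<close>
    also have "\<dots> = - (poly p (c - h) * poly p (c + h))"
      by (simp add: q algebra_simps)
    finally have neg: "poly p (c - h) * poly p (c + h) < 0"
      by simp
    have "(\<lambda>k. poly (P k) (c - h) * poly (P k) (c + h)) \<longlonglongrightarrow> poly p (c - h) * poly p (c + h)"
      using lim[of id "\<lambda>_. c - h" "c - h"] lim[of id "\<lambda>_. c + h" "c + h"]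
      by (intro tendsto_mult) (simp_all add: strict_mono_id)
    then have "\<forall>\<^sub>F k in sequentially. poly (P k) (c - h) * poly (P k) (c + h) < 0"
      using neg by (rule order_tendstoD)
    then show ?thesis
    proof eventually_elim
      case (elim k)
      obtain x where "c - h < x" "x < c + h" "poly (P k) x = 0"
        using poly_IVT[of "c - h" "c + h"] h elim by auto
      then show ?case
        using h by (intro bexI[of _ x]) (auto simp: S_iff)
    qed
  qed
  obtain K where K: "\<And>k x. x \<in> S k \<Longrightarrow> \<bar>x\<bar> \<le> K"
  proof -
    obtain E where E: "\<And>k. \<bar>eps k\<bar> \<le> E"
      using convergent_imp_Bseq[of eps] eps unfolding Bseq_def convergent_def by auto
    \<comment> \<open>\<open>K\<close> dominates the sum of the absolute entries of every
      \<open>M k\<close>, hence the modulus of every real eigenvalue, by the sum norm of an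
      eigenvector.\<close>
    define K where "K = (\<Sum>i\<in>I. \<Sum>j\<in>I. \<bar>Q i j\<bar> + E * \<bar>B i j\<bar>)"
    have E0: "E \<ge> 0"
      using E[of 0] by simp
    have "\<bar>x\<bar> \<le> K" if x: "x \<in> S k" for x k
    proof -
      from x obtain v where v: "\<exists>i\<in>I. v i \<noteq> 0" "\<And>i. i \<in> I \<Longrightarrow> (\<Sum>j\<in>I. M k i j * v j) = x * v i"
        unfolding S_def spectrum_to_mat_iff[OF I] by blast
      define n where "n = (\<Sum>i\<in>I. \<bar>v i\<bar>)"
      have n: "\<bar>v i\<bar> \<le> n" if "i \<in> I" for i
        using I that unfolding n_def by (intro member_le_sum) auto
      have "n > 0"
        using v(1) n by force
      have "\<bar>x\<bar> * n = (\<Sum>i\<in>I. \<bar>\<Sum>j\<in>I. M k i j * v j\<bar>)"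
        by (simp add: v(2) n_def sum_distrib_left abs_mult)
      also have "\<dots> \<le> (\<Sum>i\<in>I. \<Sum>j\<in>I. \<bar>M k i j * v j\<bar>)"
        by (intro sum_mono sum_abs)
      also have "\<dots> \<le> (\<Sum>i\<in>I. \<Sum>j\<in>I. (\<bar>Q i j\<bar> + E * \<bar>B i j\<bar>) * n)"
        unfolding abs_mult
      proof (intro sum_mono mult_mono)
        fix i j
        have "\<bar>M k i j\<bar> \<le> \<bar>Q i j\<bar> + \<bar>eps k * B i j\<bar>"
          by (simp add: M_def abs_triangle_ineq)
        also have "\<bar>eps k * B i j\<bar> \<le> E * \<bar>B i j\<bar>"
          unfolding abs_mult by (intro mult_right_mono E) simp
        finally show "\<bar>M k i j\<bar> \<le> \<bar>Q i j\<bar> + E * \<bar>B i j\<bar>" by simp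
      qed (use n E0 in auto)
      also have "\<dots> = K * n"
        unfolding K_def sum_distrib_right ..
      finally show ?thesis
        using \<open>n > 0\<close> by simp
    qed
    then show ?thesis
      using that by blast
  qed
  \<comment> \<open>Otherwise some subsequence of eigenvalues stays above \<open>c + e\<close>.
    Being bounded, it accumulates at a root of \<open>p\<close> that is larger than the maximal root
    \<open>c\<close>.\<close>
  have upper: "\<forall>\<^sub>F k in sequentially. \<forall>x\<in>S k. x < c + e" if e: "e > 0" for e
  proof (rule ccontr)
    assume "\<not> ?thesis"
    then obtain s :: "nat \<Rightarrow> nat" where s: "strict_mono s" "\<And>n. \<exists>x\<in>S (s n). c + e \<le> x"
      using not_eventually_sequentiallyD[of "\<lambda>k. \<forall>x\<in>S k. x < c + e"] by (metis not_less)
    then obtain y where y: "\<And>n. y n \<in> S (s n)" "\<And>n. c + e \<le> y n"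
      by metis
    obtain g :: "nat \<Rightarrow> nat" where g: "strict_mono g" "monoseq (\<lambda>n. y (g n))"
      using seq_monosub[of y] by blast
    have "Bseq (\<lambda>n. y (g n))"
      by (rule BseqI'[of _ K]) (use K y in auto)
    then obtain x where x: "(\<lambda>n. y (g n)) \<longlonglongrightarrow> x"
      using Bseq_monoseq_convergent[OF _ g(2)] unfolding convergent_def by blast
    have "(\<lambda>n. poly (P ((s \<circ> g) n)) (y (g n))) \<longlonglongrightarrow> poly p x"
      by (rule lim[OF strict_mono_o[OF s(1) g(1)] x])
    moreover have "poly (P ((s \<circ> g) n)) (y (g n)) = 0" for n
      using y(1)[of "g n"] by (simp add: S_iff)
    ultimately have "poly p x = 0"
      by (simp add: LIMSEQ_const_iff)
    then have "x \<le> c"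
      unfolding c lambda_max_def
      by (intro Max_ge) (auto simp: finite_spectrum_to_mat spectrum_to_mat_iff_poly p_def)
    moreover have "c + e \<le> x"
      by (rule LIMSEQ_le_const[OF x]) (use y in auto)
    ultimately show False
      using e by simp
  qed
  have "\<forall>\<^sub>F k in sequentially. S k \<noteq> {}"
    using near[of 1] by (auto elim: eventually_mono)
  then show "\<forall>\<^sub>F k in sequentially. spectrum (to_mat I (\<lambda>i j. Q i j + eps k * B i j)) \<noteq> {}"
    by (simp add: S_def M_def)
  show "(\<lambda>k. lambda_max I (\<lambda>i j. Q i j + eps k * B i j)) \<longlonglongrightarrow> c"
  proof (rule tendstoI)
    fix e :: real assume e: "e > 0"
    show "\<forall>\<^sub>F k in sequentially. dist (lambda_max I (\<lambda>i j. Q i j + eps k * B i j)) c < e"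
      using near[OF e] upper[OF e]
    proof eventually_elim
      case (elim k)
      then obtain x where x: "x \<in> S k" "\<bar>x - c\<bar> < e" by blast
      then have "x \<le> Max (S k)" "Max (S k) \<in> S k"
        using finS[of k] by (auto intro: Max_ge Max_in)
      then have "\<bar>Max (S k) - c\<bar> < e"
        using elim x by force
      then show ?case
        by (simp add: dist_real_def lambda_max_def S_def M_def)
    qed
  qed
qed

text \<open>Split an eigenvector \<open>x\<close> of \<open>Q + e B\<close> as \<open>(l \<bullet> x) r + w\<close> with \<open>l \<bullet> w = 0\<close>. The matrix
  \<open>S = Q - c + r l\<^sup>T\<close> is invertible and \<open>S w = (\<mu> - c) x - e B x\<close> is small, hence so is \<open>w\<close>;
  pairing the eigenvalue equation with \<open>l\<close> gives \<open>(\<mu> - c) (l \<bullet> x) = e (l \<bullet> B x)\<close>.\<close>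

lemma eigenvalue_expansion:
  fixes Q B :: "'i \<Rightarrow> 'i \<Rightarrow> real" and r l :: "'i \<Rightarrow> real"
  assumes I: "finite I" and simple: "alg_multiplicity I Q c = 1"
    and r: "\<And>i. i \<in> I \<Longrightarrow> (\<Sum>j\<in>I. Q i j * r j) = c * r i"
    and l: "\<And>j. j \<in> I \<Longrightarrow> (\<Sum>i\<in>I. l i * Q i j) = c * l j"
    and lr: "(\<Sum>i\<in>I. l i * r i) = 1"
    and alpha: "alpha = (\<Sum>i\<in>I. \<Sum>j\<in>I. l i * B i j * r j)"
  shows "\<exists>h>0. \<exists>K. \<forall>e \<mu>. \<bar>e\<bar> < h \<longrightarrow> \<bar>\<mu> - c\<bar> < h \<longrightarrow>
    \<mu> \<in> spectrum (to_mat I (\<lambda>i j. Q i j + e * B i j)) \<longrightarrow> \<bar>\<mu> - (c + alpha * e)\<bar> \<le> K * e\<^sup>2"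
proof -
  define S where "S = (\<lambda>i j. Q i j - (if i = j then c else 0) + r i * l j)"
  have S: "(\<Sum>j\<in>I. S i j * x j) = (\<Sum>j\<in>I. Q i j * x j) - c * x i + r i * (\<Sum>j\<in>I. l j * x j)"
    if "i \<in> I" for i x
  proof -
    have "(\<Sum>j\<in>I. S i j * x j) =
        (\<Sum>j\<in>I. Q i j * x j - (if i = j then c * x j else 0) + r i * (l j * x j))"
      by (rule sum.cong) (auto simp: S_def algebra_simps)
    then show ?thesis
      using I that by (simp add: sum.distrib sum_subtractf sum_distrib_left)
  qed
  have lQ: "(\<Sum>i\<in>I. l i * (\<Sum>j\<in>I. Q i j * x j)) = c * (\<Sum>i\<in>I. l i * x i)" for x
  proof -
    have "(\<Sum>i\<in>I. l i * (\<Sum>j\<in>I. Q i j * x j)) = (\<Sum>j\<in>I. (\<Sum>i\<in>I. l i * Q i j) * x j)"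
      by (simp add: sum_distrib_left sum_distrib_right mult.assoc) (rule sum.swap)
    then show ?thesis
      by (simp add: l sum_distrib_left mult.assoc)
  qed
  have nz: "\<exists>i\<in>I. r i \<noteq> 0"
    using lr by (intro ccontr[of "\<exists>i\<in>I. r i \<noteq> 0"]) simp
  \<comment> \<open>If \<open>S x = 0\<close>, pairing with \<open>l\<close> gives
    \<open>l \<bullet> x = 0\<close>. Then \<open>x\<close> is an eigenvector of \<open>Q\<close>
    for \<open>c\<close>, hence a multiple of \<open>r\<close>, and \<open>l \<bullet> r = 1\<close>
    forces it to vanish.\<close>
  have "det (to_mat I S) \<noteq> 0"
  proof
    assume "det (to_mat I S) = 0"
    then obtain x where x: "\<exists>i\<in>I. x i \<noteq> 0" "\<And>i. i \<in> I \<Longrightarrow> (\<Sum>j\<in>I. S i j * x j) = 0"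
      unfolding det_to_mat_eq_0_iff[OF I] by blast
    have "0 = (\<Sum>i\<in>I. l i * (\<Sum>j\<in>I. S i j * x j))"
      using x by simp
    also have "\<dots> = (\<Sum>i\<in>I. l i * (\<Sum>j\<in>I. Q i j * x j) - c * (l i * x i)
        + l i * r i * (\<Sum>j\<in>I. l j * x j))"
      by (intro sum.cong refl, subst S) (simp_all add: algebra_simps)
    also have "\<dots> = (\<Sum>i\<in>I. l i * (\<Sum>j\<in>I. Q i j * x j)) - c * (\<Sum>i\<in>I. l i * x i)
        + (\<Sum>i\<in>I. l i * r i) * (\<Sum>j\<in>I. l j * x j)"
      by (simp add: sum.distrib sum_subtractf sum_distrib_left[symmetric] sum_distrib_right[symmetric])
    finally have lx: "(\<Sum>j\<in>I. l j * x j) = 0"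
      by (simp add: lQ lr)
    then have "(\<Sum>j\<in>I. Q i j * x j) = c * x i" if "i \<in> I" for i
      using x(2)[OF that] S[OF that] by simp
    then obtain t where t: "\<And>i. i \<in> I \<Longrightarrow> x i = t * r i"
      using simple_eigenvectors_proportional[OF I simple r nz] by blast
    have "(\<Sum>j\<in>I. l j * x j) = t * (\<Sum>i\<in>I. l i * r i)"
      by (simp add: t sum_distrib_left mult.left_commute)
    then have "t = 0"
      using lx lr by simp
    then show False
      using x(1) t by auto
  qed
  then obtain N where N: "\<And>x i. i \<in> I \<Longrightarrow> (\<Sum>j\<in>I. N i j * (\<Sum>k\<in>I. S j k * x k)) = x i"
    using to_mat_left_inverse[OF I] by blast
  define CN CB R L where "CN = (\<Sum>i\<in>I. \<Sum>j\<in>I. \<bar>N i j\<bar>)" and "CB = (\<Sum>i\<in>I. \<Sum>j\<in>I. \<bar>B i j\<bar>)"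
    and "R = (\<Sum>i\<in>I. \<bar>r i\<bar>)" and "L = (\<Sum>i\<in>I. \<bar>l i\<bar>)"
  have nonneg: "CN \<ge> 0" "CB \<ge> 0" "L \<ge> 0"
    by (auto simp: CN_def CB_def L_def intro!: sum_nonneg)
  have R: "R > 0"
  proof -
    obtain i where "i \<in> I" "r i \<noteq> 0" using nz by blast
    then show ?thesis
      unfolding R_def using I by (intro sum_pos2[of _ i]) auto
  qed
  have bound: "(\<Sum>i\<in>I. \<bar>\<Sum>j\<in>I. A i j * y j\<bar>) \<le> (\<Sum>i\<in>I. \<Sum>j\<in>I. \<bar>A i j\<bar>) * b"
    if "\<And>j. j \<in> I \<Longrightarrow> \<bar>y j\<bar> \<le> b" for A :: "'i \<Rightarrow> 'i \<Rightarrow> real" and y b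
  proof -
    have "(\<Sum>i\<in>I. \<bar>\<Sum>j\<in>I. A i j * y j\<bar>) \<le> (\<Sum>i\<in>I. \<Sum>j\<in>I. \<bar>A i j * y j\<bar>)"
      by (intro sum_mono sum_abs)
    also have "\<dots> \<le> (\<Sum>i\<in>I. \<Sum>j\<in>I. \<bar>A i j\<bar> * b)"
      unfolding abs_mult using that by (intro sum_mono mult_left_mono) auto
    finally show ?thesis
      by (simp add: sum_distrib_right)
  qed
  have lB: "\<bar>\<Sum>i\<in>I. l i * (\<Sum>j\<in>I. B i j * y j)\<bar> \<le> L * (CB * b)"
    if "\<And>j. j \<in> I \<Longrightarrow> \<bar>y j\<bar> \<le> b" for y b
  proof -
    have "\<bar>\<Sum>i\<in>I. l i * (\<Sum>j\<in>I. B i j * y j)\<bar> \<le> (\<Sum>i\<in>I. \<bar>l i\<bar> * \<bar>\<Sum>j\<in>I. B i j * y j\<bar>)"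
      unfolding abs_mult[symmetric] by (rule sum_abs)
    also have "\<dots> \<le> (\<Sum>i\<in>I. \<bar>l i\<bar> * (CB * b))"
    proof (intro sum_mono mult_left_mono)
      fix i assume "i \<in> I"
      then have "\<bar>\<Sum>j\<in>I. B i j * y j\<bar> \<le> (\<Sum>i\<in>I. \<bar>\<Sum>j\<in>I. B i j * y j\<bar>)"
        using I by (intro member_le_sum) auto
      also have "\<dots> \<le> CB * b"
        unfolding CB_def by (rule bound[OF that])
      finally show "\<bar>\<Sum>j\<in>I. B i j * y j\<bar> \<le> CB * b" .
    qed auto
    finally show ?thesis
      by (simp add: L_def sum_distrib_right)
  qed
  \<comment> \<open>Chosen to make \<open>CN * (h + h * CB)\<close> at most one half; the summand 1
    keeps the denominator positive when \<open>CN = 0\<close>.\<close>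
  define h where "h = 1 / (2 * (CN * (1 + CB) + 1))"
  \<comment> \<open>The outer \<open>2 * R\<close> is the cost of dividing by \<open>t\<close>, the
    last bracket bounds \<open>D\<close> by a multiple of \<open>\<bar>e\<bar>\<close>, and
    \<open>CN\<close> leads from \<open>D\<close> to \<open>w\<close>.\<close>
  define K where "K = 2 * R * (L * (CB * (CN * (2 * R * (L * CB) + CB))))"
  have pos: "CN * (1 + CB) + 1 > 0"
    using nonneg by (simp add: add_nonneg_pos)
  then have h: "h > 0"
    by (simp add: h_def)
  have hCN: "CN * (h + h * CB) \<le> 1/2"
  proof -
    have "CN * (h + h * CB) = (CN * (1 + CB)) / (2 * (CN * (1 + CB) + 1))"
      by (simp add: h_def add_divide_distrib algebra_simps)
    also have "\<dots> \<le> 1/2"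
      using pos by (simp add: field_simps)
    finally show ?thesis .
  qed
  have "\<bar>\<mu> - (c + alpha * e)\<bar> \<le> K * e\<^sup>2"
    if e: "\<bar>e\<bar> < h" and mu: "\<bar>\<mu> - c\<bar> < h"
      and spec: "\<mu> \<in> spectrum (to_mat I (\<lambda>i j. Q i j + e * B i j))" for e \<mu>
  proof -
    from spec obtain x0 where x0: "\<exists>i\<in>I. x0 i \<noteq> 0"
      "\<And>i. i \<in> I \<Longrightarrow> (\<Sum>j\<in>I. (Q i j + e * B i j) * x0 j) = \<mu> * x0 i"
      unfolding spectrum_to_mat_iff[OF I] by blast
    define n where "n = (\<Sum>i\<in>I. \<bar>x0 i\<bar>)"
    obtain i0 where "i0 \<in> I" "x0 i0 \<noteq> 0" using x0(1) by blast
    then have "n > 0"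
      unfolding n_def using I by (intro sum_pos2[of _ i0]) auto
    \<comment> \<open>Normalised in the sum norm, so that the bounds do not depend on the
      eigenvector.\<close>
    define x where "x = (\<lambda>i. x0 i / n)"
    have norm_x: "(\<Sum>i\<in>I. \<bar>x i\<bar>) = 1"
      using \<open>n > 0\<close> by (simp add: x_def n_def sum_divide_distrib[symmetric])
    have x1: "\<bar>x i\<bar> \<le> 1" if "i \<in> I" for i
      using member_le_sum[OF that _ I, of "\<lambda>i. \<bar>x i\<bar>"] norm_x by simp
    have ev: "(\<Sum>j\<in>I. Q i j * x j) + e * (\<Sum>j\<in>I. B i j * x j) = \<mu> * x i" if "i \<in> I" for i
    proof -
      have "(\<Sum>j\<in>I. Q i j * x j) + e * (\<Sum>j\<in>I. B i j * x j) = (\<Sum>j\<in>I. (Q i j + e * B i j) * x j)"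
        by (simp add: distrib_right sum.distrib sum_distrib_left mult.assoc)
      also have "\<dots> = (\<Sum>j\<in>I. (Q i j + e * B i j) * x0 j) / n"
        by (simp add: x_def sum_divide_distrib)
      finally show ?thesis
        by (simp add: x0(2)[OF that] x_def)
    qed
    define t where "t = (\<Sum>i\<in>I. l i * x i)"
    define w where "w = (\<lambda>i. x i - t * r i)"
    define D where "D = \<bar>\<mu> - c\<bar> + \<bar>e\<bar> * CB"
    have "(\<Sum>j\<in>I. l j * w j) = (\<Sum>j\<in>I. l j * x j) - t * (\<Sum>j\<in>I. l j * r j)"
      by (simp add: w_def algebra_simps sum_subtractf sum_distrib_left)
    then have lw: "(\<Sum>j\<in>I. l j * w j) = 0"
      by (simp add: lr t_def)
    have Sw: "(\<Sum>j\<in>I. S i j * w j) = (\<mu> - c) * x i - e * (\<Sum>j\<in>I. B i j * x j)" if "i \<in> I" for i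
    proof -
      have "(\<Sum>j\<in>I. Q i j * w j) = (\<Sum>j\<in>I. Q i j * x j) - t * (\<Sum>j\<in>I. Q i j * r j)"
        by (simp add: w_def algebra_simps sum_subtractf sum_distrib_left)
      then have "(\<Sum>j\<in>I. S i j * w j) = (\<Sum>j\<in>I. Q i j * x j) - t * (c * r i) - c * w i"
        using S[OF that] lw r[OF that] by simp
      then show ?thesis
        using ev[OF that] by (simp add: w_def algebra_simps)
    qed
    have "\<bar>\<Sum>j\<in>I. S i j * w j\<bar> \<le> D" if i: "i \<in> I" for i
    proof -
      have "\<bar>\<Sum>j\<in>I. B i j * x j\<bar> \<le> (\<Sum>i\<in>I. \<bar>\<Sum>j\<in>I. B i j * x j\<bar>)"
        using I i by (intro member_le_sum) auto
      also have "\<dots> \<le> CB"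
        using bound[of x 1 B] x1 by (simp add: CB_def)
      finally have "\<bar>e\<bar> * \<bar>\<Sum>j\<in>I. B i j * x j\<bar> \<le> \<bar>e\<bar> * CB"
        by (simp add: mult_left_mono)
      moreover have "\<bar>\<mu> - c\<bar> * \<bar>x i\<bar> \<le> \<bar>\<mu> - c\<bar>"
        using x1[OF i] by (simp add: mult_left_le)
      ultimately show ?thesis
        unfolding Sw[OF i] D_def
        using abs_triangle_ineq4[of "(\<mu> - c) * x i" "e * (\<Sum>j\<in>I. B i j * x j)"]
        unfolding abs_mult by linarith
    qed
    then have "(\<Sum>i\<in>I. \<bar>\<Sum>j\<in>I. N i j * (\<Sum>k\<in>I. S j k * w k)\<bar>) \<le> (\<Sum>i\<in>I. \<Sum>j\<in>I. \<bar>N i j\<bar>) * D"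
      by (intro bound)
    then have norm_w: "(\<Sum>i\<in>I. \<bar>w i\<bar>) \<le> CN * D"
      by (simp add: N CN_def)
    have w1: "\<bar>w i\<bar> \<le> CN * D" if "i \<in> I" for i
      using member_le_sum[OF that _ I, of "\<lambda>i. \<bar>w i\<bar>"] norm_w by simp
    have "D \<le> h + h * CB"
      unfolding D_def using e mu nonneg by (intro add_mono mult_right_mono) auto
    then have "CN * D \<le> CN * (h + h * CB)"
      using nonneg by (intro mult_left_mono) auto
    with hCN have CND: "CN * D \<le> 1/2" by simp
    \<comment> \<open>Since \<open>w\<close> has norm at most one half, the component along
      \<open>r\<close> carries the rest. This keeps \<open>t\<close> away from 0 and permits
      division by it.\<close>
    have "1 = (\<Sum>i\<in>I. \<bar>t * r i + w i\<bar>)"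
      by (simp add: w_def norm_x)
    also have "\<dots> \<le> (\<Sum>i\<in>I. \<bar>t\<bar> * \<bar>r i\<bar> + \<bar>w i\<bar>)"
      unfolding abs_mult[symmetric] by (intro sum_mono abs_triangle_ineq)
    also have "\<dots> = \<bar>t\<bar> * R + (\<Sum>i\<in>I. \<bar>w i\<bar>)"
      by (simp add: sum.distrib R_def sum_distrib_left)
    finally have "1/2 \<le> \<bar>t\<bar> * R"
      using norm_w CND by simp
    then have div_t: "y \<le> 2 * R * z" if "y * \<bar>t\<bar> \<le> z" "y \<ge> 0" for y z :: real
    proof -
      have "y * (1/2) \<le> y * (\<bar>t\<bar> * R)"
        using \<open>1/2 \<le> \<bar>t\<bar> * R\<close> that(2) by (rule mult_left_mono)
      also have "\<dots> = (y * \<bar>t\<bar>) * R"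
        by simp
      also have "\<dots> \<le> z * R"
        using that(1) R by (intro mult_right_mono) auto
      finally show ?thesis
        by (simp add: algebra_simps)
    qed
    have split: "(\<Sum>i\<in>I. l i * (a i + e * b i)) = (\<Sum>i\<in>I. l i * a i) + e * (\<Sum>i\<in>I. l i * b i)"
      for a b :: "'i \<Rightarrow> real"
      by (simp add: algebra_simps sum.distrib sum_distrib_left)
    have "(\<Sum>i\<in>I. l i * (\<mu> * x i)) =
        (\<Sum>i\<in>I. l i * ((\<Sum>j\<in>I. Q i j * x j) + e * (\<Sum>j\<in>I. B i j * x j)))"
      by (intro sum.cong refl) (simp add: ev)
    also have "\<dots> = c * t + e * (\<Sum>i\<in>I. l i * (\<Sum>j\<in>I. B i j * x j))"
      unfolding split lQ t_def ..
    also have "(\<Sum>i\<in>I. l i * (\<mu> * x i)) = \<mu> * t"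
      by (simp add: t_def sum_distrib_left mult.left_commute)
    finally have pair: "(\<mu> - c) * t = e * (\<Sum>i\<in>I. l i * (\<Sum>j\<in>I. B i j * x j))"
      by (simp add: algebra_simps)
    \<comment> \<open>A crude first-order bound on \<open>\<mu> - c\<close> comes first. It makes
      \<open>D\<close>, and with it \<open>w\<close>, of order \<open>e\<close>.\<close>
    have "\<bar>\<mu> - c\<bar> * \<bar>t\<bar> \<le> \<bar>e\<bar> * (L * (CB * 1))"
      unfolding abs_mult[symmetric] pair unfolding abs_mult
      by (intro mult_left_mono lB x1) auto
    from div_t[OF this] have first: "\<bar>\<mu> - c\<bar> \<le> 2 * R * (\<bar>e\<bar> * (L * CB))" by simp
    \<comment> \<open>Inserting \<open>x = t r + w\<close> splits off the term with
      \<open>alpha\<close>; the remainder is \<open>e\<close> times a quantity of the size of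
      \<open>w\<close>, hence of second order.\<close>
    have "(\<Sum>i\<in>I. l i * (\<Sum>j\<in>I. B i j * x j)) =
        (\<Sum>i\<in>I. \<Sum>j\<in>I. t * (l i * B i j * r j) + l i * (B i j * w j))"
      unfolding sum_distrib_left by (intro sum.cong refl) (simp add: w_def algebra_simps)
    also have "\<dots> = t * alpha + (\<Sum>i\<in>I. l i * (\<Sum>j\<in>I. B i j * w j))"
      by (simp add: alpha sum.distrib sum_distrib_left)
    finally have "(\<mu> - (c + alpha * e)) * t = e * (\<Sum>i\<in>I. l i * (\<Sum>j\<in>I. B i j * w j))"
      using pair by (simp add: algebra_simps)
    then have "\<bar>\<mu> - (c + alpha * e)\<bar> * \<bar>t\<bar> = \<bar>e\<bar> * \<bar>\<Sum>i\<in>I. l i * (\<Sum>j\<in>I. B i j * w j)\<bar>"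
      by (simp only: abs_mult[symmetric])
    also have "\<dots> \<le> \<bar>e\<bar> * (L * (CB * (CN * D)))"
      by (intro mult_left_mono lB w1) auto
    also have "\<dots> \<le> \<bar>e\<bar> * (L * (CB * (CN * (\<bar>e\<bar> * (2 * R * (L * CB) + CB)))))"
      using first nonneg by (intro mult_left_mono) (auto simp: D_def algebra_simps)
    also have "\<dots> = (L * (CB * (CN * (2 * R * (L * CB) + CB)))) * (\<bar>e\<bar> * \<bar>e\<bar>)"
      by (simp only: mult_ac)
    also have "\<bar>e\<bar> * \<bar>e\<bar> = e\<^sup>2"
      by (simp add: power2_eq_square)
    finally have "\<bar>\<mu> - (c + alpha * e)\<bar> \<le> 2 * R * ((L * (CB * (CN * (2 * R * (L * CB) + CB)))) * e\<^sup>2)"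
      by (rule div_t) simp
    then show ?thesis
      by (simp add: K_def mult.assoc)
  qed
  with h show ?thesis by blast
qed

section \<open>Branches of a rooted tree\<close>

text \<open>Loop erasure: if the new first vertex already occurs on the path, everything before that
  occurrence is cut off. The form \<open>xs @ [b]\<close> keeps the path nonempty with a visible
  end, also for \<open>a = b\<close>.\<close>

lemma rtrancl_simple_path:
  assumes "(a, b) \<in> r\<^sup>*"
  shows "\<exists>xs. hd (xs @ [b]) = a \<and> distinct (xs @ [b]) \<and> successively (\<lambda>x y. (x, y) \<in> r) (xs @ [b])"
  using assms
proof (induction rule: converse_rtrancl_induct)
  case base
  show ?case by (intro exI[of _ "[]"]) simp
next
  case (step a c)
  then obtain xs where xs: "hd (xs @ [b]) = c" "distinct (xs @ [b])"
    "successively (\<lambda>x y. (x, y) \<in> r) (xs @ [b])" by blast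
  consider "a \<notin> set (xs @ [b])" | "a = b" | ys zs where "xs = ys @ a # zs"
    by (metis Un_iff empty_iff empty_set insert_iff list.simps(15) set_append split_list)
  then show ?case
  proof cases
    case 1
    have "successively (\<lambda>x y. (x, y) \<in> r) (a # (xs @ [b]))"
      using xs step.hyps(1) by (cases "xs @ [b]") auto
    with 1 xs show ?thesis
      by (intro exI[of _ "a # xs"]) simp
  next
    case 2
    then show ?thesis by (intro exI[of _ "[]"]) simp
  next
    case 3
    with xs show ?thesis
      by (intro exI[of _ "a # zs"]) (auto simp: successively_append_iff)
  qed
qed

locale rooted_tree =
  fixes T :: "'a ugraph" and v :: 'a
  assumes tree: "finite_tree T" and v: "v \<in> verts T"
begin

abbreviation "D \<equiv> delete_vertex T v"

lemma finite_verts: "finite (verts T)"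
  using tree by (simp add: finite_tree_def finite_simple_graph_def)

lemma edge_subset: "e \<in> edges T \<Longrightarrow> e \<subseteq> verts T"
  and card_edge: "e \<in> edges T \<Longrightarrow> card e = 2"
  using tree by (auto simp: finite_tree_def finite_simple_graph_def)

lemma finite_edges: "finite (edges T)"
proof (rule finite_subset)
  show "edges T \<subseteq> Pow (verts T)"
    using edge_subset by blast
qed (simp add: finite_verts)

lemma finite_edge: "e \<in> edges T \<Longrightarrow> finite e"
  using card_edge by (metis card.infinite zero_neq_numeral)

lemma edge_other_end:
  assumes "e \<in> edges T" "x \<in> e"
  obtains y where "e = {x, y}" "y \<noteq> x"
  using card_edge[OF assms(1)] assms(2) by (auto simp: card_2_iff)

lemma neighbor_neq: "u \<in> neighbors T v \<Longrightarrow> u \<noteq> v"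
  using card_edge by (fastforce simp: neighbors_def)

lemma finite_neighbors: "finite (neighbors T v)"
proof (rule finite_subset)
  show "neighbors T v \<subseteq> verts T"
    using edge_subset by (auto simp: neighbors_def)
qed (rule finite_verts)

lemma root_edges_iff:
  assumes "e \<in> edges T"
  shows "e \<in> root_edges T v \<longleftrightarrow> v \<in> e"
proof
  assume "v \<in> e"
  with assms obtain y where "e = {v, y}"
    by (rule edge_other_end)
  with assms show "e \<in> root_edges T v"
    by (auto simp: root_edges_def neighbors_def)
qed (auto simp: root_edges_def)

section \<open>Separation of the branches\<close>

lemma sym_adj: "sym (adj G)"
  by (auto simp: adj_def sym_def insert_commute)

lemma adj_delete_vertex: "(x, y) \<in> adj D \<longleftrightarrow> (x, y) \<in> adj T \<and> x \<noteq> v \<and> y \<noteq> v"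
  by (auto simp: adj_def delete_vertex_def)

text \<open>A simple path between two different neighbours that avoids \<open>v\<close> closes up
  through \<open>v\<close> to a cycle.\<close>

lemma neighbors_separated:
  assumes u: "u \<in> neighbors T v" and u': "u' \<in> neighbors T v" and path: "(u, u') \<in> (adj D)\<^sup>*"
  shows "u = u'"
proof (rule ccontr)
  assume "u \<noteq> u'"
  obtain xs where xs: "hd (xs @ [u']) = u" "distinct (xs @ [u'])"
    "successively (\<lambda>x y. (x, y) \<in> adj D) (xs @ [u'])"
    using rtrancl_simple_path[OF path] by blast
  define ys where "ys = xs @ [u']"
  have step: "(ys ! i, ys ! Suc i) \<in> adj D" if "Suc i < length ys" for i
    using xs(3) that by (simp add: ys_def[symmetric] successively_conv_nth)
  have len: "length ys \<ge> 2"
    using xs(1) \<open>u \<noteq> u'\<close> by (cases xs) (auto simp: ys_def)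
  \<comment> \<open>Every vertex but the last starts an edge of \<open>D\<close>, and the last one
    is a neighbour of \<open>v\<close>.\<close>
  have v_notin: "v \<notin> set ys"
  proof
    assume "v \<in> set ys"
    then obtain i where i: "i < length ys" "ys ! i = v"
      by (auto simp: in_set_conv_nth)
    show False
    proof (cases "Suc i < length ys")
      case True
      then show False
        using step[OF True] i by (simp add: adj_delete_vertex)
    next
      case False
      then have "ys ! i = u'"
        using i by (simp add: ys_def nth_append)
      then show False
        using i neighbor_neq[OF u'] by simp
    qed
  qed
  have "is_cycle T (v # ys)"
    unfolding is_cycle_def
  proof (intro conjI allI impI)
    show "3 \<le> length (v # ys)" "distinct (v # ys)"
      using len v_notin xs(2) by (simp_all add: ys_def)
    fix i assume i: "i < length (v # ys)"
    \<comment> \<open>The three cases are the edge leaving \<open>v\<close>, an edge of the path,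
      and the closing edge, where the index wraps around to 0.\<close>
    consider "i = 0" | j where "i = Suc j" "Suc j < length ys" | "i = length ys"
      using i by (cases i) (auto simp: less_Suc_eq)
    then show "{(v # ys) ! i, (v # ys) ! (Suc i mod length (v # ys))} \<in> edges T"
    proof cases
      case 1
      moreover have "ys ! 0 = u"
        using xs(1) by (simp add: ys_def hd_conv_nth)
      moreover have "Suc 0 mod Suc (length ys) = Suc 0"
        using len by (intro mod_less) linarith
      ultimately show ?thesis
        using u by (simp add: neighbors_def)
    next
      case 2
      then show ?thesis
        using step[of j] by (simp add: adj_delete_vertex) (simp add: adj_def)
    next
      case 3
      then have "(v # ys) ! i = u'"
        using len by (simp add: ys_def nth_append)
      with 3 show ?thesis
        using u' by (simp add: neighbors_def insert_commute)
    qed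
  qed
  then show False
    using tree by (auto simp: finite_tree_def)
qed

text \<open>Follow a walk from \<open>v\<close> to \<open>x\<close>; each time it leaves
  \<open>v\<close>, the starting neighbour is chosen anew.\<close>

lemma reachable_from_neighbor:
  assumes "x \<in> verts T" "x \<noteq> v"
  shows "\<exists>u\<in>neighbors T v. (u, x) \<in> (adj D)\<^sup>*"
proof -
  have "(v, x) \<in> (adj T)\<^sup>*"
    using tree v assms(1) by (simp add: finite_tree_def connected_graph_def)
  then have "x = v \<or> (\<exists>u\<in>neighbors T v. (u, x) \<in> (adj D)\<^sup>*)"
  proof (induction rule: rtrancl_induct)
    case (step y z)
    show ?case
    proof (cases "z = v \<or> y = v")
      case True
      then show ?thesis
        using step.hyps(2) by (auto simp: adj_def neighbors_def)
    next
      case False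
      then have "(y, z) \<in> adj D"
        using step.hyps(2) by (simp add: adj_delete_vertex)
      then show ?thesis
        using step.IH False by (meson rtrancl.rtrancl_into_rtrancl)
    qed
  qed simp
  with assms(2) show ?thesis by simp
qed

lemma v_notin_component: "v \<notin> component D u"
  by (simp add: component_def delete_vertex_def)

lemma component_iff:
  assumes "x \<in> verts T" "x \<noteq> v"
  shows "x \<in> component D u \<longleftrightarrow> (u, x) \<in> (adj D)\<^sup>*"
  using assms by (simp add: component_def delete_vertex_def)

lemma unique_component:
  assumes "x \<in> verts T" "x \<noteq> v"
  obtains u where "u \<in> neighbors T v"
    and "\<And>u'. u' \<in> neighbors T v \<Longrightarrow> x \<in> component D u' \<longleftrightarrow> u' = u"
proof -
  obtain u where u: "u \<in> neighbors T v" "(u, x) \<in> (adj D)\<^sup>*"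
    using reachable_from_neighbor[OF assms] by blast
  have uniq: "u' = u" if "u' \<in> neighbors T v" "(u', x) \<in> (adj D)\<^sup>*" for u'
  proof (rule neighbors_separated[OF that(1) u(1)])
    have "(x, u) \<in> (adj D)\<^sup>*"
      using u(2) sym_rtrancl[OF sym_adj] by (meson symD)
    with that(2) show "(u', u) \<in> (adj D)\<^sup>*" by (rule rtrancl_trans)
  qed
  show ?thesis
    by (rule that[OF u(1)]) (use u(2) uniq component_iff[OF assms] in blast)
qed

text \<open>The branch of an edge can be read off at either endpoint other than \<open>v\<close>, so
  two edges meeting outside \<open>v\<close> lie in the same branch.\<close>

lemma branch_edges_iff:
  assumes e: "e \<in> edges T" and x: "x \<in> e" "x \<noteq> v" and u: "u \<in> neighbors T v"
  shows "e \<in> branch_edges T v u \<longleftrightarrow> x \<in> component D u"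
proof
  have uT: "u \<in> verts T" "u \<noteq> v"
    using u edge_subset neighbor_neq by (auto simp: neighbors_def)
  assume "e \<in> branch_edges T v u"
  then show "x \<in> component D u"
    using x component_iff[OF uT, of u] by (auto simp: branch_edges_def)
next
  assume xC: "x \<in> component D u"
  obtain y where y: "e = {x, y}" "y \<noteq> x"
    using edge_other_end[OF e x(1)] .
  have xy: "x \<in> verts T" "y \<in> verts T"
    using edge_subset[OF e] y by auto
  have ux: "(u, x) \<in> (adj D)\<^sup>*"
    using xC component_iff[OF xy(1) x(2)] by simp
  show "e \<in> branch_edges T v u"
  \<comment> \<open>If the other end is \<open>v\<close>, then \<open>x\<close> is itself a
    neighbour, and separation forces \<open>x = u\<close>.\<close>
  proof (cases "y = v")
    case True
    then have "x \<in> neighbors T v"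
      using e y by (simp add: neighbors_def insert_commute)
    then have "u = x"
      using neighbors_separated[OF u _ ux] by simp
    then show ?thesis
      using y True by (auto simp: branch_edges_def)
  next
    case False
    have "(x, y) \<in> adj D"
      using e y x(2) False unfolding adj_delete_vertex by (simp add: adj_def)
    then have "y \<in> component D u"
      using ux component_iff[OF xy(2) False] by (meson rtrancl.rtrancl_into_rtrancl)
    then show ?thesis
      using xC y e by (simp add: branch_edges_def)
  qed
qed

section \<open>The limit matrix without reference to branches\<close>

lemma branch_edges_at_v: "v \<in> e \<Longrightarrow> e \<in> branch_edges T v u \<Longrightarrow> e = {v, u}"
  using v_notin_component by (auto simp: branch_edges_def)

text \<open>The Ricci matrix with the reciprocal degree of \<open>v\<close> replaced by 0, that is,
  its formal limit as that degree tends to infinity.\<close>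

definition ricci_inf :: "'a set \<Rightarrow> 'a set \<Rightarrow> real" where
  "ricci_inf e f =
     (if e = f then - (\<Sum>x\<in>e - {v}. 1 / real (vdegree T x))
      else (\<Sum>z\<in>e \<inter> f - {v}. 1 / real (vdegree T z)))"

text \<open>Within one branch only the root edge contains \<open>v\<close>, so \<open>v\<close>
  matters in a single diagonal entry, the one that \<open>branch_matrix\<close> modifies.\<close>

lemma branch_matrix_eq_ricci_inf:
  assumes u: "u \<in> neighbors T v" and e: "e \<in> branch_edges T v u" and f: "f \<in> branch_edges T v u"
  shows "branch_matrix T v u e f = ricci_inf e f"
proof (cases "v \<in> e \<inter> f")
  case True
  then have "e = {v, u}" "f = {v, u}"
    using e f branch_edges_at_v by auto
  then show ?thesis
    using neighbor_neq[OF u] by (simp add: branch_matrix_def ricci_inf_def)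
next
  case False
  then have "e \<inter> f - {v} = e \<inter> f"
    by blast
  with False show ?thesis
    by (auto simp: branch_matrix_def ricci_inf_def ricci_def)
qed

text \<open>Edges with a common vertex outside \<open>v\<close> share exactly one branch, so one
  summand survives. Without such a vertex every summand vanishes, and so does
  \<open>ricci_inf\<close>.\<close>

lemma Q_inf_eq_ricci_inf:
  assumes e: "e \<in> edges T" and f: "f \<in> edges T"
  shows "Q_inf T v (Some e) (Some f) = ricci_inf e f"
proof (cases "\<exists>z\<in>e \<inter> f. z \<noteq> v")
  case True
  then obtain z where z: "z \<in> e" "z \<in> f" "z \<noteq> v" by blast
  then have "z \<in> verts T"
    using edge_subset[OF e] by blast
  then obtain u where u: "u \<in> neighbors T v"
    and uniq: "\<And>u'. u' \<in> neighbors T v \<Longrightarrow> z \<in> component D u' \<longleftrightarrow> u' = u"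
    using unique_component z(3) by blast
  have "e \<in> branch_edges T v u' \<and> f \<in> branch_edges T v u' \<longleftrightarrow> u' = u" if "u' \<in> neighbors T v" for u'
    using that branch_edges_iff[OF e z(1,3)] branch_edges_iff[OF f z(2,3)] uniq by simp
  then have "(if e \<in> branch_edges T v u' \<and> f \<in> branch_edges T v u' then branch_matrix T v u' e f else 0) =
      (if u' = u then ricci_inf e f else 0)" if "u' \<in> neighbors T v" for u'
    using that branch_matrix_eq_ricci_inf[OF that] by auto
  then have "Q_inf T v (Some e) (Some f) =
      (\<Sum>u'\<in>neighbors T v. if u' = u then ricci_inf e f else 0)"
    by simp
  then show ?thesis
    using u finite_neighbors by simp
next
  case False
  then have empty: "e \<inter> f - {v} = {}" by blast
  \<comment> \<open>Equality would place a two-element edge inside \<open>{v}\<close>.\<close>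
  have "e \<noteq> f"
    using False card_edge[OF e] card_mono[of "{v}" e] by force
  then have "ricci_inf e f = 0"
    unfolding ricci_inf_def empty by simp
  then show ?thesis
    by (auto intro!: sum.neutral simp: branch_matrix_eq_ricci_inf)
qed

end

section \<open>Attaching pendant edges\<close>

context rooted_tree
begin

definition pend :: "nat \<Rightarrow> ('a + nat) set" where
  "pend i = {Inl v, Inr i}"

text \<open>The reciprocal of the degree of \<open>v\<close> in \<open>Tk k\<close>.\<close>

definition eps :: "nat \<Rightarrow> real" where
  "eps k = 1 / real (vdegree T v + k)"

text \<open>For \<open>k > 0\<close> this is the quotient of the Ricci matrix in which the pendant
  edges are merged into \<open>None\<close>, which carries their common value.\<close>

definition quotient_matrix :: "nat \<Rightarrow> 'a set option \<Rightarrow> 'a set option \<Rightarrow> real" where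
  "quotient_matrix k i j = Q_inf T v i j + eps k * B_mat T v i j"

abbreviation "Tk k \<equiv> attach_pendants T v k"

lemma inj_on_image_Inl: "inj_on ((`) Inl) A"
  by (simp add: inj_on_def inj_image_eq_iff)

lemma inj_on_pend: "inj_on pend A"
  by (auto simp: inj_on_def pend_def doubleton_eq_iff)

lemma pend_neq_old [simp]: "pend i \<noteq> Inl ` e" "Inl ` e \<noteq> pend i"
  by (auto simp: pend_def)

lemma edges_attach: "edges (Tk k) = (`) Inl ` edges T \<union> pend ` {..<k}"
  by (simp add: attach_pendants_def pend_def)

lemma finite_edges_attach: "finite (edges (Tk k))"
  by (simp add: edges_attach finite_edges)

lemma sum_edges_attach:
  "(\<Sum>g\<in>edges (Tk k). h g) = (\<Sum>f\<in>edges T. h (Inl ` f)) + (\<Sum>i<k. h (pend i))"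
  for h :: "('a + nat) set \<Rightarrow> real"
proof -
  have "(\<Sum>g\<in>edges (Tk k). h g) = sum h ((`) Inl ` edges T) + sum h (pend ` {..<k})"
    unfolding edges_attach by (rule sum.union_disjoint) (auto simp: finite_edges)
  then show ?thesis
    by (simp add: sum.reindex inj_on_image_Inl inj_on_pend)
qed

section \<open>Degrees and Ricci entries of the enlarged tree\<close>

lemma vdegree_attach_Inl: "vdegree (Tk k) (Inl x) = vdegree T x + (if x = v then k else 0)"
proof -
  have "{e \<in> edges (Tk k). Inl x \<in> e} =
      (`) Inl ` {e \<in> edges T. x \<in> e} \<union> pend ` {i. i < k \<and> x = v}"
    by (auto simp: edges_attach pend_def)
  also have "card \<dots> = card ((`) Inl ` {e \<in> edges T. x \<in> e} :: ('a + nat) set set) + card (pend ` {i. i < k \<and> x = v})"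
    by (rule card_Un_disjoint) (auto simp: finite_edges)
  also have "\<dots> = vdegree T x + (if x = v then k else 0)"
    by (simp add: card_image inj_on_image_Inl inj_on_pend vdegree_def)
  finally show ?thesis
    by (simp add: vdegree_def)
qed

lemma vdegree_attach_Inr:
  assumes "i < k"
  shows "vdegree (Tk k) (Inr i) = 1"
proof -
  have "{e \<in> edges (Tk k). Inr i \<in> e} = {pend i}"
    using assms by (auto simp: edges_attach pend_def)
  then show ?thesis
    by (simp add: vdegree_def)
qed

text \<open>Among the old vertices only \<open>v\<close> changes its degree; splitting off its term
  separates \<open>ricci_inf\<close> from the perturbation.\<close>

lemma sum_inverse_vdegree_attach:
  assumes "finite A"
  shows "(\<Sum>z\<in>Inl ` A. 1 / real (vdegree (Tk k) z)) =
    (\<Sum>x\<in>A - {v}. 1 / real (vdegree T x)) + (if v \<in> A then eps k else 0)"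
proof -
  let ?h = "\<lambda>x. 1 / real (vdegree (Tk k) (Inl x))"
  have "(\<Sum>z\<in>Inl ` A. 1 / real (vdegree (Tk k) z)) = sum ?h A"
    by (simp add: sum.reindex)
  also have "\<dots> = sum ?h (A - {v}) + (if v \<in> A then ?h v else 0)"
    using assms by (simp add: sum.remove[of A v ?h])
  also have "sum ?h (A - {v}) = (\<Sum>x\<in>A - {v}. 1 / real (vdegree T x))"
    by (intro sum.cong refl) (simp add: vdegree_attach_Inl)
  also have "?h v = eps k"
    by (simp add: vdegree_attach_Inl eps_def)
  finally show ?thesis .
qed

lemma ricci_attach_old:
  assumes e: "e \<in> edges T" and f: "f \<in> edges T"
  shows "ricci (Tk k) (Inl ` e) (Inl ` f) = quotient_matrix k (Some e) (Some f)"
proof -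
  have "ricci (Tk k) (Inl ` e) (Inl ` f) =
      ricci_inf e f + eps k * (if v \<in> e \<and> v \<in> f then if e = f then - 1 else 1 else 0)"
  proof (cases "e = f")
    case True
    then show ?thesis
      using sum_inverse_vdegree_attach[OF finite_edge[OF e], of k]
      by (simp add: ricci_def ricci_inf_def)
  next
    case False
    then have neq: "(Inl ` e :: ('a + nat) set) \<noteq> Inl ` f"
      by (simp add: inj_image_eq_iff)
    have int: "(Inl ` e :: ('a + nat) set) \<inter> Inl ` f = Inl ` (e \<inter> f)"
      by blast
    have "finite (e \<inter> f)"
      using finite_edge[OF e] by simp
    from sum_inverse_vdegree_attach[OF this, of k] show ?thesis
      unfolding ricci_def ricci_inf_def int using False neq by simp
  qed
  then show ?thesis
    unfolding quotient_matrix_def Q_inf_eq_ricci_inf[OF e f] by (simp add: root_edges_iff e f)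
qed

lemma ricci_attach_mixed:
  assumes "e \<in> edges T"
  shows "ricci (Tk k) (Inl ` e) (pend i) = (if v \<in> e then eps k else 0)"
    and "ricci (Tk k) (pend i) (Inl ` e) = (if v \<in> e then eps k else 0)"
proof -
  have "Inl ` e \<inter> pend i = (if v \<in> e then {Inl v} else {})"
    "pend i \<inter> Inl ` e = (if v \<in> e then {Inl v} else {})"
    by (auto simp: pend_def)
  then show "ricci (Tk k) (Inl ` e) (pend i) = (if v \<in> e then eps k else 0)"
    "ricci (Tk k) (pend i) (Inl ` e) = (if v \<in> e then eps k else 0)"
    by (auto simp: ricci_def vdegree_attach_Inl eps_def)
qed

text \<open>The pendant block is \<open>eps k\<close> times the all-ones matrix minus a multiple of
  the identity, which explains the extra eigenvalue on functions of sum 0.\<close>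

lemma ricci_attach_pend:
  assumes "i < k"
  shows "ricci (Tk k) (pend i) (pend j) = eps k - (if i = j then 1 + 2 * eps k else 0)"
proof (cases "i = j")
  case True
  then show ?thesis
    using assms by (simp add: ricci_def pend_def vdegree_attach_Inl vdegree_attach_Inr eps_def)
next
  case False
  then have "pend i \<noteq> pend j" "pend i \<inter> pend j = {Inl v}"
    by (auto simp: pend_def)
  then show ?thesis
    using False by (simp add: ricci_def vdegree_attach_Inl eps_def)
qed

section \<open>Row sums of the Ricci matrix\<close>

lemma ricci_row_old:
  assumes e: "e \<in> edges T"
  shows "(\<Sum>g\<in>edges (Tk k). ricci (Tk k) (Inl ` e) g * X g) =
    (\<Sum>f\<in>edges T. quotient_matrix k (Some e) (Some f) * X (Inl ` f)) + (if v \<in> e then eps k * (\<Sum>i<k. X (pend i)) else 0)"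
  unfolding sum_edges_attach
  by (simp add: ricci_attach_old ricci_attach_mixed e sum_distrib_left)

lemma ricci_row_pend:
  assumes i: "i < k"
  shows "(\<Sum>g\<in>edges (Tk k). ricci (Tk k) (pend i) g * X g) =
    eps k * (\<Sum>f\<in>edges T. if v \<in> f then X (Inl ` f) else 0)
    + eps k * (\<Sum>j<k. X (pend j)) - (1 + 2 * eps k) * X (pend i)"
proof -
  have "(\<Sum>j<k. ricci (Tk k) (pend i) (pend j) * X (pend j)) =
      (\<Sum>j<k. eps k * X (pend j) - (if i = j then (1 + 2 * eps k) * X (pend j) else 0))"
    by (intro sum.cong refl) (simp add: ricci_attach_pend i algebra_simps)
  also have "\<dots> = eps k * (\<Sum>j<k. X (pend j)) - (1 + 2 * eps k) * X (pend i)"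
    using i by (simp add: sum_subtractf sum_distrib_left)
  finally have "(\<Sum>j<k. ricci (Tk k) (pend i) (pend j) * X (pend j)) =
      eps k * (\<Sum>j<k. X (pend j)) - (1 + 2 * eps k) * X (pend i)" .
  moreover have "(\<Sum>f\<in>edges T. ricci (Tk k) (pend i) (Inl ` f) * X (Inl ` f)) =
      eps k * (\<Sum>f\<in>edges T. if v \<in> f then X (Inl ` f) else 0)"
    unfolding sum_distrib_left by (intro sum.cong refl) (simp add: ricci_attach_mixed)
  ultimately show ?thesis
    unfolding sum_edges_attach by simp
qed

section \<open>The quotient matrix and comparison of the spectra\<close>

lemma finite_ext_edges: "finite (ext_edges T)"
  by (simp add: ext_edges_def finite_edges)

lemma sum_ext_edges: "(\<Sum>j\<in>ext_edges T. h j) = (\<Sum>f\<in>edges T. h (Some f)) + h None"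
  for h :: "'a set option \<Rightarrow> real"
  unfolding ext_edges_def by (subst sum.insert) (auto simp: finite_edges sum.reindex)

text \<open>This identity turns the entry \<open>1 - eps k * d\<close> in column
  \<open>None\<close>, with \<open>d\<close> the degree of \<open>v\<close> in \<open>T\<close>,
  into the total weight of \<open>k\<close> pendant edges.\<close>

lemma eps_times: "k > 0 \<Longrightarrow> eps k * real k = 1 - eps k * real (vdegree T v)"
  by (simp add: eps_def field_simps)

lemma quotient_matrix_row_Some:
  assumes e: "e \<in> edges T" and k: "k > 0"
  shows "(\<Sum>j\<in>ext_edges T. quotient_matrix k (Some e) j * x j) =
    (\<Sum>f\<in>edges T. quotient_matrix k (Some e) (Some f) * x (Some f)) + (if v \<in> e then eps k * (real k * x None) else 0)"
proof -
  have "quotient_matrix k (Some e) None = (if v \<in> e then eps k * real k else 0)"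
    using eps_times[OF k] by (simp add: quotient_matrix_def root_edges_iff e)
  then show ?thesis
    by (simp add: sum_ext_edges)
qed

lemma quotient_matrix_row_None:
  "(\<Sum>j\<in>ext_edges T. quotient_matrix k None j * x j) =
    eps k * (\<Sum>f\<in>edges T. if v \<in> f then x (Some f) else 0) - eps k * (real (vdegree T v) + 2) * x None"
proof -
  have "(\<Sum>f\<in>edges T. quotient_matrix k None (Some f) * x (Some f)) =
      eps k * (\<Sum>f\<in>edges T. if v \<in> f then x (Some f) else 0)"
    unfolding sum_distrib_left by (intro sum.cong refl) (simp add: quotient_matrix_def root_edges_iff)
  then show ?thesis
    by (simp add: sum_ext_edges quotient_matrix_def) (simp add: algebra_simps)
qed

text \<open>An eigenvector of the quotient lifts by giving every pendant edge the value at
  \<open>None\<close>.\<close>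

lemma spectrum_quotient_matrix_subset:
  assumes k: "k > 0" and c: "c \<in> spectrum (to_mat (ext_edges T) (quotient_matrix k))"
  shows "c \<in> spectrum (to_mat (edges (Tk k)) (ricci (Tk k)))"
proof -
  obtain x where nz: "\<exists>i\<in>ext_edges T. x i \<noteq> 0"
    and x: "\<And>i. i \<in> ext_edges T \<Longrightarrow> (\<Sum>j\<in>ext_edges T. quotient_matrix k i j * x j) = c * x i"
    using c unfolding spectrum_to_mat_iff[OF finite_ext_edges] by blast
  define X where "X = (\<lambda>g :: ('a + nat) set. if g \<in> range pend then x None else x (Some (Inl -` g)))"
  have X_pend: "X (pend i) = x None" for i
    by (simp add: X_def)
  have X_old: "X (Inl ` e) = x (Some e)" for e
    by (auto simp: X_def inj_vimage_image_eq)
  show ?thesis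
    unfolding spectrum_to_mat_iff[OF finite_edges_attach]
  proof (intro exI[of _ X] conjI ballI)
    from nz consider "x None \<noteq> 0" | e where "e \<in> edges T" "x (Some e) \<noteq> 0"
      by (auto simp: ext_edges_def)
    then show "\<exists>g\<in>edges (Tk k). X g \<noteq> 0"
    proof cases
      case 1
      then show ?thesis
        using k by (intro bexI[of _ "pend 0"]) (auto simp: edges_attach X_pend)
    next
      case 2
      then show ?thesis
        by (intro bexI[of _ "Inl ` e"]) (auto simp: edges_attach X_old)
    qed
    fix g assume "g \<in> edges (Tk k)"
    then consider e where "e \<in> edges T" "g = Inl ` e" | i where "i < k" "g = pend i"
      by (auto simp: edges_attach)
    then show "(\<Sum>f\<in>edges (Tk k). ricci (Tk k) g f * X f) = c * X g"
    proof cases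
      case 1
      then have "Some e \<in> ext_edges T"
        by (simp add: ext_edges_def)
      from x[OF this] show ?thesis
        unfolding 1(2) ricci_row_old[OF 1(1)] quotient_matrix_row_Some[OF 1(1) k]
        by (simp add: X_old X_pend split: if_splits)
    next
      case 2
      have "None \<in> ext_edges T"
        by (simp add: ext_edges_def)
      from x[OF this]
      have "c * x None = eps k * (\<Sum>f\<in>edges T. if v \<in> f then x (Some f) else 0)
          - eps k * (real (vdegree T v) + 2) * x None"
        unfolding quotient_matrix_row_None by simp
      \<comment> \<open>This identifies the coefficient \<open>- (d + 2)\<close> in
        \<open>B_mat\<close>: the pendant edges contribute \<open>eps k * k\<close> in all, less the
        diagonal correction \<open>1 + 2 * eps k\<close>.\<close>
      also have "eps k * (real (vdegree T v) + 2) = 1 + 2 * eps k - eps k * real k"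
        using eps_times[OF k] by (simp add: algebra_simps)
      finally show ?thesis
        unfolding 2(2) ricci_row_pend[OF 2(1)] X_old X_pend
        by (simp add: algebra_simps)
    qed
  qed
qed

text \<open>Averaging an eigenvector over the pendant edges gives an eigenvector of \<open>quotient_matrix k\<close>, unless the
  average vanishes; then the eigenvector lives on the pendant edges and has coordinate sum \<open>0\<close>.\<close>

lemma spectrum_ricci_subset:
  assumes k: "k > 0" and c: "c \<in> spectrum (to_mat (edges (Tk k)) (ricci (Tk k)))"
    and exc: "c \<noteq> - (1 + 2 * eps k)"
  shows "c \<in> spectrum (to_mat (ext_edges T) (quotient_matrix k))"
proof -
  obtain X where nz: "\<exists>g\<in>edges (Tk k). X g \<noteq> 0"
    and X: "\<And>g. g \<in> edges (Tk k) \<Longrightarrow> (\<Sum>f\<in>edges (Tk k). ricci (Tk k) g f * X f) = c * X g"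
    using c unfolding spectrum_to_mat_iff[OF finite_edges_attach] by blast
  define s where "s = (\<Sum>i<k. X (pend i))"
  define x where "x = (\<lambda>j. case j of None \<Rightarrow> s / real k | Some e \<Rightarrow> X (Inl ` e))"
  define t where "t = eps k * (\<Sum>f\<in>edges T. if v \<in> f then X (Inl ` f) else 0)"
  have x_simps: "x (Some e) = X (Inl ` e)" "real k * x None = s" for e
    using k by (simp_all add: x_def)
  have pend_eq: "c * X (pend i) = t + eps k * s - (1 + 2 * eps k) * X (pend i)" if "i < k" for i
    using X[of "pend i"] that unfolding ricci_row_pend[OF that] by (simp add: edges_attach s_def t_def)
  show ?thesis
    unfolding spectrum_to_mat_iff[OF finite_ext_edges]
  proof (intro exI[of _ x] conjI ballI)
    show "\<exists>j\<in>ext_edges T. x j \<noteq> 0"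
    proof (rule ccontr)
      assume "\<not> ?thesis"
      then have old: "\<And>e. e \<in> edges T \<Longrightarrow> X (Inl ` e) = 0" and "x None = 0"
        by (auto simp: ext_edges_def x_simps(1)[symmetric])
      then have "s = 0" "t = 0"
        using x_simps(2) by (auto simp: t_def intro!: sum.neutral)
      obtain i where "i < k" "X (pend i) \<noteq> 0"
        using nz old by (auto simp: edges_attach)
      then have "c = - (1 + 2 * eps k)"
        using pend_eq[of i] \<open>s = 0\<close> \<open>t = 0\<close> by (metis add_0 diff_0 minus_mult_left mult_cancel_right mult_zero_right)
      with exc show False ..
    qed
    fix j assume "j \<in> ext_edges T"
    then consider "j = None" | e where "e \<in> edges T" "j = Some e"
      by (auto simp: ext_edges_def)
    then show "(\<Sum>i\<in>ext_edges T. quotient_matrix k j i * x i) = c * x j"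
    proof cases
      case 1
      \<comment> \<open>Adding the \<open>k\<close> pendant equations gives \<open>k\<close> times
        the equation for the index \<open>None\<close>.\<close>
      have "c * s = (\<Sum>i<k. c * X (pend i))"
        by (simp add: s_def sum_distrib_left)
      also have "\<dots> = (\<Sum>i<k. t + eps k * s - (1 + 2 * eps k) * X (pend i))"
        by (intro sum.cong refl) (simp add: pend_eq)
      also have "\<dots> = real k * (t + eps k * s) - (1 + 2 * eps k) * s"
        by (simp add: sum_subtractf sum_distrib_left[symmetric] s_def)
      finally have "c * (real k * x None) = real k * (t + eps k * (real k * x None)) - (1 + 2 * eps k) * (real k * x None)"
        unfolding x_simps .
      then have "real k * (c * x None) = real k * (t + (eps k * real k) * x None - (1 + 2 * eps k) * x None)"
        by (simp add: algebra_simps)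
      then have "c * x None = t + (eps k * real k) * x None - (1 + 2 * eps k) * x None"
        using k by simp
      then show ?thesis
        unfolding 1 quotient_matrix_row_None eps_times[OF k] x_simps(1) t_def[symmetric]
        by (simp add: algebra_simps)
    next
      case 2
      then have "Inl ` e \<in> edges (Tk k)"
        by (simp add: edges_attach)
      from X[OF this] show ?thesis
        unfolding 2(2) ricci_row_old[OF 2(1)] quotient_matrix_row_Some[OF 2(1) k] x_simps s_def .
    qed
  qed
qed

text \<open>The spectra can differ only by \<open>- (1 + 2 * eps k)\<close>, which is at most
  \<open>- 1\<close> and so cannot be the maximum.\<close>

lemma lambda_max_ricci_eq:
  assumes k: "k > 0" and ne: "spectrum (to_mat (ext_edges T) (quotient_matrix k)) \<noteq> {}"
    and gt: "lambda_max (ext_edges T) (quotient_matrix k) > - 1"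
  shows "lambda_max (edges (Tk k)) (ricci (Tk k)) = lambda_max (ext_edges T) (quotient_matrix k)"
  unfolding lambda_max_def[of "edges (Tk k)"]
proof (rule Max_eqI)
  let ?S = "spectrum (to_mat (ext_edges T) (quotient_matrix k))"
  have fin: "finite ?S"
    by (rule finite_spectrum_to_mat)
  show "lambda_max (ext_edges T) (quotient_matrix k) \<in> spectrum (to_mat (edges (Tk k)) (ricci (Tk k)))"
    using Max_in[OF fin ne] by (intro spectrum_quotient_matrix_subset[OF k]) (simp add: lambda_max_def)
  fix c assume c: "c \<in> spectrum (to_mat (edges (Tk k)) (ricci (Tk k)))"
  show "c \<le> lambda_max (ext_edges T) (quotient_matrix k)"
  proof (cases "c = - (1 + 2 * eps k)")
    case True
    moreover have "eps k \<ge> 0"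
      by (simp add: eps_def)
    ultimately show ?thesis
      using gt by simp
  next
    case False
    then show ?thesis
      unfolding lambda_max_def by (intro Max_ge fin spectrum_ricci_subset[OF k c])
  qed
qed (rule finite_spectrum_to_mat)

section \<open>Passage to the limit\<close>

lemma eps_tendsto_0: "eps \<longlonglongrightarrow> 0"
proof -
  have "(\<lambda>k. 1 / real (k + vdegree T v)) \<longlonglongrightarrow> 0"
    by (rule LIMSEQ_ignore_initial_segment[OF lim_1_over_n])
  then show ?thesis
    by (simp add: eps_def[abs_def] add.commute)
qed

lemma lambda_max_Q_inf_nonneg: "lambda_max (ext_edges T) (Q_inf T v) \<ge> 0"
  unfolding lambda_max_def
proof (rule Max_ge)
  show "0 \<in> spectrum (to_mat (ext_edges T) (Q_inf T v))"
    by (rule zero_row_imp_zero_in_spectrum[OF finite_ext_edges, of None]) (simp_all add: ext_edges_def)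
qed (rule finite_spectrum_to_mat)

end

theorem proposition4:
  fixes T :: "'a ugraph" and v :: 'a and d :: nat
    and lam :: "nat \<Rightarrow> real" and lam_inf alpha :: real
    and r l :: "'a set option \<Rightarrow> real"
  assumes "finite_tree T" and "edges T \<noteq> {}" and "v \<in> verts T"
    and "d = vdegree T v"
    and "\<And>k. lam k = lambda_max (edges (attach_pendants T v k)) (ricci (attach_pendants T v k))"
    and "lam_inf = lambda_max (ext_edges T) (Q_inf T v)"
    and "alg_multiplicity (ext_edges T) (Q_inf T v) lam_inf = 1"
    and "\<And>i. i \<in> ext_edges T \<Longrightarrow> (\<Sum>j\<in>ext_edges T. Q_inf T v i j * r j) = lam_inf * r i"
    and "\<And>j. j \<in> ext_edges T \<Longrightarrow> (\<Sum>i\<in>ext_edges T. l i * Q_inf T v i j) = lam_inf * l j"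
    and "(\<Sum>i\<in>ext_edges T. l i * r i) = 1"
    and "alpha = (\<Sum>i\<in>ext_edges T. \<Sum>j\<in>ext_edges T. l i * B_mat T v i j * r j)"
  shows "(\<lambda>k. lam k - (lam_inf + alpha / real (d + k))) \<in> O(\<lambda>k. 1 / (real (d + k))\<^sup>2)"
proof -
  interpret rooted_tree T v
    by unfold_locales (rule assms)+
  define mu where "mu = (\<lambda>k. lambda_max (ext_edges T) (quotient_matrix k))"
  have quotient_matrix_eq: "quotient_matrix k = (\<lambda>i j. Q_inf T v i j + eps k * B_mat T v i j)" for k
    by (simp add: quotient_matrix_def fun_eq_iff)
  have mu: "mu \<longlonglongrightarrow> lam_inf"
    and ne: "\<forall>\<^sub>F k in sequentially. spectrum (to_mat (ext_edges T) (quotient_matrix k)) \<noteq> {}"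
    using tendsto_lambda_max[OF finite_ext_edges eps_tendsto_0 assms(6,7), of "B_mat T v"]
    unfolding quotient_matrix_eq mu_def by blast+
  obtain h K where h: "h > 0"
    and expansion: "\<And>e \<mu>. \<bar>e\<bar> < h \<Longrightarrow> \<bar>\<mu> - lam_inf\<bar> < h \<Longrightarrow>
      \<mu> \<in> spectrum (to_mat (ext_edges T) (\<lambda>i j. Q_inf T v i j + e * B_mat T v i j)) \<Longrightarrow>
      \<bar>\<mu> - (lam_inf + alpha * e)\<bar> \<le> K * e\<^sup>2"
    using eigenvalue_expansion[OF finite_ext_edges assms(7-11)] by blast
  \<comment> \<open>By convergence \<open>mu k\<close> eventually exceeds \<open>- 1\<close> as
    well, which rules out the exceptional eigenvalue as maximum.\<close>
  have "lam_inf > - 1"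
    using lambda_max_Q_inf_nonneg assms(6) by simp
  then have gt: "\<forall>\<^sub>F k in sequentially. mu k > - 1"
    by (rule order_tendstoD(1)[OF mu])
  have "\<forall>\<^sub>F k in sequentially. \<bar>eps k\<bar> < h" "\<forall>\<^sub>F k in sequentially. \<bar>mu k - lam_inf\<bar> < h"
    using tendstoD[OF eps_tendsto_0 h] tendstoD[OF mu h] by (simp_all add: dist_real_def)
  then have "\<forall>\<^sub>F k in sequentially.
      norm (lam k - (lam_inf + alpha / real (d + k))) \<le> K * norm (1 / (real (d + k))\<^sup>2)"
    using gt ne eventually_gt_at_top[of 0]
  proof eventually_elim
    case (elim k)
    have "lam k = mu k"
      using lambda_max_ricci_eq[OF elim(5,4)] elim(3) assms(5)[of k] by (simp add: mu_def)
    moreover have "mu k \<in> spectrum (to_mat (ext_edges T) (quotient_matrix k))"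
      unfolding mu_def lambda_max_def by (rule Max_in[OF finite_spectrum_to_mat elim(4)])
    ultimately have "\<bar>lam k - (lam_inf + alpha * eps k)\<bar> \<le> K * (eps k)\<^sup>2"
      using expansion[OF elim(1,2)] unfolding quotient_matrix_eq by simp
    then show ?case
      by (simp add: eps_def assms(4) power_divide)
  qed
  then show ?thesis
    by (rule bigoI)
qed

end
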